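(* Let $\mathbb{F}_q$ be a finite field with $q\equiv -1\pmod 3$. There exist exactly $q-1$ isomorphism classes (over $\mathbb{F}_q$) of elliptic curves $E$ over $\mathbb{F}_q$ such that $\#E(\mathbb{F}_q)$ is a multiple of $3$. A parametrization of these classes (each class occurring exactly once) is given by the family $$\{\,y^2+axy+y=x^3 \;:\; a\in\mathbb{F}_q,\ a\neq 3\,\}.$$ *)

theory Defs
  imports "HOL-Library.Cardinality" "HOL-Algebra.Algebraic_Closure_Type" "HOL-Number_Theory.Cong"
begin

(* A point of the projective plane is the set of all its homogeneous coordinate vectors. *)

type_synonym 'a ppoint = "('a \<times> 'a \<times> 'a) set"

definition proj_pt :: "'a::field \<times> 'a \<times> 'a \<Rightarrow> 'a ppoint" where
  "proj_pt p = (case p of (x, y, z) \<Rightarrow> {(c * x, c * y, c * z) | c. c \<noteq> 0})"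

(* Weierstrass a1 a2 a3 a4 a6 is the projective plane cubic with affine equation
   y^2 + a1 x y + a3 y = x^3 + a2 x^2 + a4 x + a6. *)

datatype 'a weierstrass = Weierstrass 'a 'a 'a 'a 'a

fun wcubic :: "'a::field weierstrass \<Rightarrow> 'a \<times> 'a \<times> 'a \<Rightarrow> 'a" where
  "wcubic (Weierstrass a1 a2 a3 a4 a6) (x, y, z) =
     y^2 * z + a1 * x * y * z + a3 * y * z^2
       - (x^3 + a2 * x^2 * z + a4 * x * z^2 + a6 * z^3)"

(* The partial derivatives of wcubic with respect to x, y and z. *)

fun wcubic_grad :: "'a::field weierstrass \<Rightarrow> 'a \<times> 'a \<times> 'a \<Rightarrow> 'a \<times> 'a \<times> 'a" where
  "wcubic_grad (Weierstrass a1 a2 a3 a4 a6) (x, y, z) =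
     (a1 * y * z - (3 * x^2 + 2 * a2 * x * z + a4 * z^2),
      2 * y * z + a1 * x * z + a3 * z^2,
      y^2 + a1 * x * y + 2 * a3 * y * z - (a2 * x^2 + 2 * a4 * x * z + 3 * a6 * z^2))"

definition points :: "'a::field weierstrass \<Rightarrow> 'a ppoint set" where
  "points E = {proj_pt p | p. p \<noteq> (0, 0, 0) \<and> wcubic E p = 0}"

abbreviation base_change :: "'a::field weierstrass \<Rightarrow> 'a alg_closure weierstrass" where
  "base_change \<equiv> map_weierstrass to_ac"

(* Smoothness is required at all points over the algebraic closure; the base point is
   always (0 : 1 : 0). *)

definition elliptic_curve :: "'a::field weierstrass \<Rightarrow> bool" where
  "elliptic_curve E \<longleftrightarrow>
     (\<forall>p. p \<noteq> (0, 0, 0) \<and> wcubic (base_change E) p = 0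
        \<longrightarrow> wcubic_grad (base_change E) p \<noteq> (0, 0, 0))"

(* A form of degree d in x, y, z over the ground field, given by its coefficients
   (c i j is the coefficient of x^i y^j z^(d-i-j)) and evaluated over the algebraic closure. *)

fun form :: "nat \<Rightarrow> (nat \<Rightarrow> nat \<Rightarrow> 'a::field)
    \<Rightarrow> 'a alg_closure \<times> 'a alg_closure \<times> 'a alg_closure \<Rightarrow> 'a alg_closure" where
  "form d c (x, y, z) =
     (\<Sum>i\<le>d. \<Sum>j\<le>d - i. to_ac (c i j) * x^i * y^j * z^(d - i - j))"

(* Morphisms defined over the ground field, in the classical sense: a map on the points over
   the algebraic closure which near every point is given by three forms of the same degree
   over the ground field. *)

definition curve_morphism :: "'a::field weierstrass \<Rightarrow> 'a weierstrass
    \<Rightarrow> ('a alg_closure ppoint \<Rightarrow> 'a alg_closure ppoint) \<Rightarrow> bool" where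
  "curve_morphism E E' \<phi> \<longleftrightarrow>
     \<phi> ` points (base_change E) \<subseteq> points (base_change E') \<and>
     (\<forall>P\<in>points (base_change E). \<exists>d f g h.
        (\<exists>p\<in>P. (form d f p, form d g p, form d h p) \<noteq> (0, 0, 0)) \<and>
        (\<forall>Q\<in>points (base_change E). \<forall>p\<in>Q.
           (form d f p, form d g p, form d h p) \<noteq> (0, 0, 0) \<longrightarrow>
             \<phi> Q = proj_pt (form d f p, form d g p, form d h p)))"

definition isomorphic :: "'a::field weierstrass \<Rightarrow> 'a weierstrass \<Rightarrow> bool" where
  "isomorphic E E' \<longleftrightarrow>
     (\<exists>\<phi> \<psi>. curve_morphism E E' \<phi> \<and> curve_morphism E' E \<psi> \<and>
        (\<forall>P\<in>points (base_change E). \<psi> (\<phi> P) = P) \<and>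
        (\<forall>P\<in>points (base_change E'). \<phi> (\<psi> P) = P) \<and>
        \<phi> (proj_pt (0, 1, 0)) = proj_pt (0, 1, 0))"

definition iso_rel :: "('a::field weierstrass \<times> 'a weierstrass) set" where
  "iso_rel = {(E, E'). elliptic_curve E \<and> elliptic_curve E' \<and> isomorphic E E'}"

definition curves_3 :: "'a::{field,finite} weierstrass set" where
  "curves_3 = {E. elliptic_curve E \<and> 3 dvd card (points E)}"

end

(*
  For rational points P, Q on E there is a unique R such that P, Q, R are the intersection of E with
  a line. Rotating such triples shows that the number of rational flexes is congruent to N^2 modulo
  3, where N = #E(F_q), so 3 | N yields an affine flex; no group law is needed. Moving the flex to
  (0, 0) with tangent y = 0 and scaling (every element has a unique cube root, as q = 2 mod 3) gives
  y^2 + a x y + y = x^3. Conversely this equation is y z (y + a x + z) = x^3 and the points with x = 1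
  are permuted freely by rotating y, z and -(y + a + z), so 3 | N.

  Distinct a give non-isomorphic curves: the coordinates of an isomorphism fixing infinity are
  regular on the affine curve, hence of the form F(x) + y G(x), and comparing pole orders at infinity
  they are linear. The flex (0, 0) goes to a rational flex; such a flex is (0, 0) or (0, -1), and then
  the coefficients give a = b c with c^3 = 1, so a^3 = b^3 and a = b.
*)

theory Submission
  imports Defs
begin

text \<open>The hypothesis on q acts through cubes: 3 is invertible and cubing is a bijection of
  F_q. Hence the discriminant a^3 - 27 vanishes only for a = 3, which explains both the excluded
  parameter and the count q - 1. As q may be a power of 2, the square in y is never completed, and
  general Weierstrass coefficients stay throughout. The obstacle is rigidity: an isomorphism is
  given only by local triples of forms on points over the closure, not as a change of variables. An
  ideal of denominators shows that its coordinates are regular functions, and the norm to k[x]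
  supplies pole orders. The resulting linear coefficients lie in the closure; rationality is
  recovered at the image of (0, 0), because the forms have coefficients in F_q. The scaling factor
  may still be a nontrivial cube root of unity of the closure, so the parameters are compared
  through their cubes.\<close>

section \<open>Counting modulo 3, and cubes in the finite field\<close>

text \<open>Outside the fixed points every orbit has exactly three elements, and orbits are
  disjoint.\<close>

lemma card_cong_card_fixpoints_mod_3:
  assumes "finite S" and maps: "\<And>x. x \<in> S \<Longrightarrow> f x \<in> S"
    and period: "\<And>x. x \<in> S \<Longrightarrow> f (f (f x)) = x"
  shows "[card S = card {x \<in> S. f x = x}] (mod 3)"
proof -
  define F where "F = {x \<in> S. f x = x}"
  define C where "C = (\<lambda>x. {x, f x, f (f x)}) ` (S - F)"
  have in_SF: "f x \<in> S - F" if "x \<in> S - F" for x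
  proof -
    have "f (f x) \<noteq> f x"
    proof
      assume "f (f x) = f x"
      then have "f x = x" using period[of x] that by simp
      with that show False by (simp add: F_def)
    qed
    then show ?thesis using that maps by (simp add: F_def)
  qed
  have moves: "f x \<noteq> x" if "x \<in> S - F" for x
    using that by (simp add: F_def)
  have orbit: "c = {z, f z, f (f z)}" if c: "c \<in> C" and "z \<in> c" for c z
  proof -
    from c obtain x where "x \<in> S" "c = {x, f x, f (f x)}" by (auto simp: C_def)
    with period[of x] \<open>z \<in> c\<close> show ?thesis by auto
  qed
  have "\<Union>C = S - F"
  proof
    show "\<Union>C \<subseteq> S - F" using in_SF by (auto simp: C_def simp del: Diff_iff)
  qed (auto simp: C_def)
  moreover have "3 dvd card (\<Union>C)"
  proof (rule dvd_partition)
    show "finite (\<Union>C)" using \<open>\<Union>C = S - F\<close> \<open>finite S\<close> by simp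
    show "\<forall>c\<in>C. 3 dvd card c"
    proof
      fix c assume "c \<in> C"
      then obtain x where x: "x \<in> S - F" and c: "c = {x, f x, f (f x)}" by (auto simp: C_def)
      have "f x \<noteq> x" "f (f x) \<noteq> f x" "f (f (f x)) \<noteq> f (f x)"
        using moves in_SF x by blast+
      then have "card c = 3" using period[of x] x by (auto simp: c card_insert_if)
      then show "3 dvd card c" by simp
    qed
    show "\<forall>c1\<in>C. \<forall>c2\<in>C. c1 \<noteq> c2 \<longrightarrow> c1 \<inter> c2 = {}"
      using orbit by blast
  qed
  ultimately have "3 dvd card S - card F"
    using \<open>finite S\<close> by (simp add: F_def card_Diff_subset)
  moreover have "card F \<le> card S"
    using \<open>finite S\<close> by (auto simp: F_def intro: card_mono)
  ultimately show ?thesis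
    unfolding F_def by (simp add: cong_altdef_nat)
qed

text \<open>In characteristic 3, adding 1 would have period 3 and no fixed point, so 3 would divide
  q.\<close>

lemma finite_field_3_neq_0:
  assumes "[CARD('a::{field,finite}) = 2] (mod 3)"
  shows "(3::'a) \<noteq> 0"
proof
  assume 3: "(3::'a) = 0"
  have "1 + (1 + (1 + x)) = x" for x :: 'a
  proof -
    have "1 + (1 + (1 + x)) = 3 + x" by simp
    then show ?thesis using 3 by simp
  qed
  then have "[CARD('a) = card {x::'a \<in> UNIV. 1 + x = x}] (mod 3)"
    by (intro card_cong_card_fixpoints_mod_3) auto
  then show False using assms by (auto simp: cong_def)
qed

text \<open>The quotient of two distinct elements with equal cubes is a nontrivial cube root of
  unity. Multiplication by it has period 3 and fixes only 0, so q would be 1 modulo 3.\<close>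

lemma inj_cube:
  assumes "[CARD('a::{field,finite}) = 2] (mod 3)"
  shows "inj (\<lambda>x::'a. x ^ 3)"
proof (rule injI)
  fix x y :: 'a assume xy: "x ^ 3 = y ^ 3"
  show "x = y"
  proof (rule ccontr)
    assume "x \<noteq> y"
    with xy have "y \<noteq> 0" by auto
    define w where "w = x / y"
    have w: "w ^ 3 = 1" "w \<noteq> 1"
      using xy \<open>x \<noteq> y\<close> \<open>y \<noteq> 0\<close> by (auto simp: w_def power_divide)
    have "[CARD('a) = card {x \<in> UNIV. w * x = x}] (mod 3)"
      using w(1) by (intro card_cong_card_fixpoints_mod_3) (auto simp: power3_eq_cube mult.assoc[symmetric])
    moreover have "{x \<in> UNIV. w * x = x} = {0}" using w(2) by auto
    ultimately show False using assms by (simp add: cong_def)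
  qed
qed

lemma surj_cube:
  assumes "[CARD('a::{field,finite}) = 2] (mod 3)"
  shows "surj (\<lambda>x::'a. x ^ 3)"
  using inj_cube[OF assms] by (rule finite_UNIV_inj_surj[rotated]) simp

section \<open>Projective points in affine coordinates\<close>

lemma in_proj_pt: "p \<in> proj_pt p"
  by (cases p) (auto simp: proj_pt_def intro!: exI[of _ 1])

lemma proj_pt_mem_iff:
  "(x', y', z') \<in> proj_pt (x, y, z) \<longleftrightarrow> (\<exists>c. c \<noteq> 0 \<and> x' = c * x \<and> y' = c * y \<and> z' = c * z)"
  by (auto simp: proj_pt_def)

lemma proj_pt_scale:
  fixes c :: "'a::field"
  assumes c: "c \<noteq> 0"
  shows "proj_pt (c * x, c * y, c * z) = proj_pt (x, y, z)"
proof (rule Set.set_eqI)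
  fix p :: "'a \<times> 'a \<times> 'a"
  obtain x' y' z' where p: "p = (x', y', z')" by (cases p)
  show "p \<in> proj_pt (c * x, c * y, c * z) \<longleftrightarrow> p \<in> proj_pt (x, y, z)"
  proof
    assume "p \<in> proj_pt (c * x, c * y, c * z)"
    then obtain d where "d \<noteq> 0" "p = (d * c * x, d * c * y, d * c * z)"
      by (auto simp: p proj_pt_mem_iff mult.assoc)
    then show "p \<in> proj_pt (x, y, z)"
      using c by (auto simp: proj_pt_mem_iff intro!: exI[of _ "d * c"])
  next
    assume "p \<in> proj_pt (x, y, z)"
    then obtain d where "d \<noteq> 0" "p = (d * x, d * y, d * z)"
      by (auto simp: p proj_pt_mem_iff)
    then show "p \<in> proj_pt (c * x, c * y, c * z)"
      using c by (auto simp: proj_pt_mem_iff intro!: exI[of _ "d / c"])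
  qed
qed

lemma proj_pt_eqI: "q \<in> proj_pt p \<Longrightarrow> proj_pt q = proj_pt p"
  by (cases p; cases q) (auto simp: proj_pt_mem_iff proj_pt_scale)

lemma proj_pt_affine_eq_iff [simp]:
  "proj_pt (x, y, 1) = proj_pt (x', y', 1) \<longleftrightarrow> x = x' \<and> y = y'"
  by (metis in_proj_pt proj_pt_mem_iff mult_1 mult.right_neutral)

lemma proj_pt_affine_neq_infinity [simp]: "proj_pt (x, y, 1) \<noteq> proj_pt (0, 1, 0)"
  "proj_pt (0, 1, 0) \<noteq> proj_pt (x, y, 1)"
  by (metis in_proj_pt proj_pt_mem_iff mult_zero_right zero_neq_one)+

definition affine_points :: "'a::field weierstrass \<Rightarrow> ('a \<times> 'a) set" where
  "affine_points E = {(x, y). wcubic E (x, y, 1) = 0}"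

text \<open>On the line z = 0 the equation reduces to x^3 = 0, which leaves only (0 : 1 :
  0).\<close>

lemma points_eq:
  "points E = insert (proj_pt (0, 1, 0)) ((\<lambda>(x, y). proj_pt (x, y, 1)) ` affine_points E)"
proof (intro equalityI subsetI)
  fix P assume "P \<in> points E"
  then obtain x y z where P: "P = proj_pt (x, y, z)" "(x, y, z) \<noteq> (0, 0, 0)" "wcubic E (x, y, z) = 0"
    by (auto simp: points_def)
  obtain a1 a2 a3 a4 a6 where E: "E = Weierstrass a1 a2 a3 a4 a6" by (cases E)
  show "P \<in> insert (proj_pt (0, 1, 0)) ((\<lambda>(x, y). proj_pt (x, y, 1)) ` affine_points E)"
  proof (cases "z = 0")
    case True
    with P(2,3) E have "x = 0" "y \<noteq> 0" by auto
    with True P(1) show ?thesis using proj_pt_scale[of y 0 1 0] by simp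
  next
    case False
    have "P = proj_pt (x / z, y / z, 1)"
      using P(1) False proj_pt_scale[of z "x / z" "y / z" 1] by simp
    moreover have "wcubic E (x, y, z) = z ^ 3 * wcubic E (x / z, y / z, 1)"
      using False by (simp add: E field_simps power2_eq_square power3_eq_cube)
    then have "wcubic E (x / z, y / z, 1) = 0" using P(3) False by simp
    ultimately show ?thesis by (auto simp: affine_points_def)
  qed
next
  fix P assume "P \<in> insert (proj_pt (0, 1, 0)) ((\<lambda>(x, y). proj_pt (x, y, 1)) ` affine_points E)"
  then show "P \<in> points E"
    by (cases E) (force simp: points_def affine_points_def)
qed

lemma card_points:
  fixes E :: "'a::{field,finite} weierstrass"
  shows "card (points E) = card (affine_points E) + 1"
proof -
  have "inj_on (\<lambda>(x, y). proj_pt (x, y, 1)) (affine_points E)"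
    by (auto simp: inj_on_def)
  moreover have "proj_pt (0, 1, 0) \<notin> (\<lambda>(x, y). proj_pt (x, y, 1)) ` affine_points E"
    by auto
  ultimately show ?thesis
    by (simp add: points_eq card_image)
qed


section \<open>Rational flexes\<close>

text \<open>\<open>None\<close> is the point at infinity, and multiplicities count: for three affine points the last three
  equations say that \<open>(x - x1) (x - x2) (x - x3)\<close> is, up to sign, the restriction of the cubic to the
  line \<open>y = s x + k\<close>. In particular, they force the points to lie on the curve.\<close>

fun collinear :: "'a::field weierstrass
    \<Rightarrow> ('a \<times> 'a) option \<Rightarrow> ('a \<times> 'a) option \<Rightarrow> ('a \<times> 'a) option \<Rightarrow> bool" where
  "collinear (Weierstrass a1 a2 a3 a4 a6) (Some (x1, y1)) (Some (x2, y2)) (Some (x3, y3)) \<longleftrightarrow>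
     (\<exists>s k. y1 = s * x1 + k \<and> y2 = s * x2 + k \<and> y3 = s * x3 + k \<and>
        x1 + x2 + x3 = s^2 + a1 * s - a2 \<and>
        x1 * x2 + x1 * x3 + x2 * x3 = a4 - 2 * s * k - a1 * k - a3 * s \<and>
        x1 * x2 * x3 = k^2 + a3 * k - a6)"
| "collinear (Weierstrass a1 a2 a3 a4 a6) None (Some (x1, y1)) (Some (x2, y2)) \<longleftrightarrow>
     x1 = x2 \<and> y1 + y2 + a1 * x1 + a3 = 0"
| "collinear (Weierstrass a1 a2 a3 a4 a6) (Some (x1, y1)) None (Some (x2, y2)) \<longleftrightarrow>
     x1 = x2 \<and> y1 + y2 + a1 * x1 + a3 = 0"
| "collinear (Weierstrass a1 a2 a3 a4 a6) (Some (x1, y1)) (Some (x2, y2)) None \<longleftrightarrow>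
     x1 = x2 \<and> y1 + y2 + a1 * x1 + a3 = 0"
| "collinear E None None None \<longleftrightarrow> True"
| "collinear E None None (Some P) \<longleftrightarrow> False"
| "collinear E None (Some P) None \<longleftrightarrow> False"
| "collinear E (Some P) None None \<longleftrightarrow> False"

lemma collinear_rotate: "collinear E P Q R \<Longrightarrow> collinear E Q R P"
  by (induction E P Q R rule: collinear.induct) (auto simp: algebra_simps, blast?)

text \<open>\<open>option\<close> gives each point a single name, so that chords and tangents can be
  treated by cases on affine coordinates.\<close>

definition cpoints :: "'a::field weierstrass \<Rightarrow> ('a \<times> 'a) option set" where
  "cpoints E = insert None (Some ` affine_points E)"

definition affine_smooth :: "'a::field weierstrass \<Rightarrow> bool" where
  "affine_smooth E \<longleftrightarrow> (\<forall>(x, y) \<in> affine_points E. wcubic_grad E (x, y, 1) \<noteq> (0, 0, 0))"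

text \<open>Euler's relation yields the third partial derivative.\<close>

lemma affine_smoothD:
  assumes "affine_smooth (Weierstrass a1 a2 a3 a4 a6)"
    and "(x, y) \<in> affine_points (Weierstrass a1 a2 a3 a4 a6)"
    and "2 * y + a1 * x + a3 = 0"
  shows "a1 * y \<noteq> 3 * x^2 + 2 * a2 * x + a4"
proof
  assume *: "a1 * y = 3 * x^2 + 2 * a2 * x + a4"
  have "y^2 + a1 * x * y + a3 * y - (x^3 + a2 * x^2 + a4 * x + a6) = 0"
    using assms(2) by (simp add: affine_points_def)
  then have "y^2 + a1 * x * y + 2 * a3 * y - (a2 * x^2 + 2 * a4 * x + 3 * a6) = 0"
    (is "?Fz = 0")
  proof -
    assume F: "y^2 + a1 * x * y + a3 * y - (x^3 + a2 * x^2 + a4 * x + a6) = 0" (is "?F = 0")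
    have "?Fz = 3 * ?F - x * (a1 * y - (3 * x^2 + 2 * a2 * x + a4)) - y * (2 * y + a1 * x + a3)"
      by (simp add: algebra_simps power2_eq_square power3_eq_cube)
    then show ?thesis using F * assms(3) by simp
  qed
  moreover have "wcubic_grad (Weierstrass a1 a2 a3 a4 a6) (x, y, 1) \<noteq> (0, 0, 0)"
    using assms(1,2) by (auto simp: affine_smooth_def)
  ultimately show False
    using * assms(3) by simp
qed

text \<open>The equations make x a double root of the restriction to the line. Eliminating z and k
  leaves s F_y + F_x = 0, the tangent direction.\<close>

lemma tangent_slope:
  fixes x :: "'a::field"
  assumes "y = s * x + k" "x + x + z = s^2 + a1 * s - a2"
    "x * x + x * z + x * z = a4 - 2 * s * k - a1 * k - a3 * s"
  shows "s * (2 * y + a1 * x + a3) = 3 * x^2 + 2 * a2 * x + a4 - a1 * y"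
  using assms by Groebner_Basis.algebra

text \<open>A cubic with two known roots has a third one, given by Vieta's formulas; smoothness
  makes the tangent unique when the two points coincide.\<close>

lemma ex1_collinear:
  assumes "affine_smooth E" "P \<in> cpoints E" "Q \<in> cpoints E"
  shows "\<exists>!R. R \<in> cpoints E \<and> collinear E P Q R"
proof -
  obtain a1 a2 a3 a4 a6 where E: "E = Weierstrass a1 a2 a3 a4 a6" by (cases E)
  \<comment> \<open>The other root of the quadratic in y over the same x, hence the third point of
    the vertical line.\<close>
  have neg: "(x, - y - a1 * x - a3) \<in> affine_points E" if "(x, y) \<in> affine_points E" for x y
    using that by (simp add: affine_points_def E) (simp add: algebra_simps power2_eq_square)
  consider "P = None" "Q = None" 
    | x y where "P = None" "Q = Some (x, y)" "(x, y) \<in> affine_points E"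
    | x y where "P = Some (x, y)" "Q = None" "(x, y) \<in> affine_points E"
    | x y x' y' where "P = Some (x, y)" "Q = Some (x', y')" "(x, y) \<in> affine_points E" "(x', y') \<in> affine_points E"
    using assms by (auto simp: cpoints_def)
  then show ?thesis
  proof cases
    case 1
    then show ?thesis by (intro ex1I[of _ None]) (auto simp: cpoints_def)
  next
    case (2 x y)
    show ?thesis
    proof (intro ex1I[of _ "Some (x, - y - a1 * x - a3)"] conjI)
      show "Some (x, - y - a1 * x - a3) \<in> cpoints E" using neg 2 by (simp add: cpoints_def)
      show "collinear E P Q (Some (x, - y - a1 * x - a3))" by (simp add: 2 E)
      show "R = Some (x, - y - a1 * x - a3)" if "R \<in> cpoints E \<and> collinear E P Q R" for R
        using that by (cases R) (auto simp: 2 E algebra_simps eq_neg_iff_add_eq_0)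
    qed
  next
    case (3 x y)
    show ?thesis
    proof (intro ex1I[of _ "Some (x, - y - a1 * x - a3)"] conjI)
      show "Some (x, - y - a1 * x - a3) \<in> cpoints E" using neg 3 by (simp add: cpoints_def)
      show "collinear E P Q (Some (x, - y - a1 * x - a3))" by (simp add: 3 E)
      show "R = Some (x, - y - a1 * x - a3)" if "R \<in> cpoints E \<and> collinear E P Q R" for R
        using that by (cases R) (auto simp: 3 E algebra_simps eq_neg_iff_add_eq_0)
    qed
  next
    case (4 x1 y1 x2 y2)
    have P: "y1^2 + a1 * x1 * y1 + a3 * y1 = x1^3 + a2 * x1^2 + a4 * x1 + a6"
      and Q: "y2^2 + a1 * x2 * y2 + a3 * y2 = x2^3 + a2 * x2^2 + a4 * x2 + a6"
      using 4 by (simp_all add: affine_points_def E)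
    have smooth: "a1 * y1 \<noteq> 3 * x1^2 + 2 * a2 * x1 + a4" if "2 * y1 + a1 * x1 + a3 = 0"
      using affine_smoothD assms(1) 4(3) that unfolding E by blast
    show ?thesis
    proof (cases "x1 = x2 \<and> y1 + y2 + a1 * x1 + a3 = 0")
      case True
      then have eq: "x1 = x2" "y1 + y2 + a1 * x1 + a3 = 0" by auto
      \<comment> \<open>Here the line is vertical. Another line through both points would force y1 =
        y2, hence F_y = 0; \<open>tangent_slope\<close> then gives F_x = 0, against
        smoothness.\<close>
      have "\<not> collinear E P Q (Some (x3, y3))" for x3 y3
      proof
        assume "collinear E P Q (Some (x3, y3))"
        then obtain s k where sk: "y1 = s * x1 + k" "y2 = s * x2 + k"
           "x1 + x2 + x3 = s^2 + a1 * s - a2"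
           "x1 * x2 + x1 * x3 + x2 * x3 = a4 - 2 * s * k - a1 * k - a3 * s"
          by (auto simp: 4 E)
        have "y1 = y2" using sk(1,2) eq(1) by simp
        have "2 * y1 + a1 * x1 + a3 = 0" using \<open>y1 = y2\<close> eq(2) by (simp only: mult_2)
        moreover have "a1 * y1 = 3 * x1^2 + 2 * a2 * x1 + a4"
          using tangent_slope[of y1 s x1 k x3 a1 a2 a4 a3] sk(1,3,4) eq(1) \<open>2 * y1 + a1 * x1 + a3 = 0\<close>
          by (metis eq_iff_diff_eq_0 mult_zero_right)
        ultimately show False using smooth by blast
      qed
      with True show ?thesis
        by (intro ex1I[of _ None]) (auto simp: cpoints_def 4 E)
    next
      case False
      \<comment> \<open>If x1 = x2, the points coincide, since opposite points are excluded here,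
        and the tangent replaces the chord. \<open>x3\<close> is read off the sum of the
        roots.\<close>
      define s where "s = (if x1 = x2 then (3 * x1^2 + 2 * a2 * x1 + a4 - a1 * y1) / (2 * y1 + a1 * x1 + a3)
         else (y1 - y2) / (x1 - x2))"
      define k where "k = y1 - s * x1"
      define x3 where "x3 = s^2 + a1 * s - a2 - x1 - x2"
      define y3 where "y3 = s * x3 + k"
      have k: "y1 = s * x1 + k" by (simp add: k_def)
      \<comment> \<open>For uniqueness the slope suffices: it determines k, and the sum of the roots
        then determines the third abscissa.\<close>
      have main: "y2 = s * x2 + k \<and>
         x1 * x2 + x1 * x3 + x2 * x3 = a4 - 2 * s * k - a1 * k - a3 * s \<and> 
         x1 * x2 * x3 = k^2 + a3 * k - a6 \<and>
        (\<forall>s' k'. y1 = s' * x1 + k' \<longrightarrow> y2 = s' * x2 + k' \<longrightarrow>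
           (\<forall>x3'. x1 + x2 + x3' = s'^2 + a1 * s' - a2 \<longrightarrow>
           x1 * x2 + x1 * x3' + x2 * x3' = a4 - 2 * s' * k' - a1 * k' - a3 * s' \<longrightarrow> s' = s))"
      proof (cases "x1 = x2")
        case True
        \<comment> \<open>Both ordinates are roots of the same quadratic over x1.\<close>
        have "(y1 - y2) * (y1 + y2 + a1 * x1 + a3) = 0" using P Q True by Groebner_Basis.algebra
        with False True have y: "y1 = y2" by auto
        have nz: "2 * y1 + a1 * x1 + a3 \<noteq> 0" using False True y by auto
        have s: "s * (2 * y1 + a1 * x1 + a3) = 3 * x1^2 + 2 * a2 * x1 + a4 - a1 * y1"
          using nz True by (simp add: s_def)
        have x3: "x1 + x1 + x3 = s^2 + a1 * s - a2" using True by (simp add: x3_def)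
        have 1: "x1 * x1 + x1 * x3 + x1 * x3 = a4 - 2 * s * k - a1 * k - a3 * s"
          using s k x3 by Groebner_Basis.algebra
        have 2: "x1 * x1 * x3 = k^2 + a3 * k - a6"
          using 1 s k x3 P by Groebner_Basis.algebra
        have "s' = s" if "y1 = s' * x1 + k'" "x1 + x1 + x3' = s'^2 + a1 * s' - a2"
          "x1 * x1 + x1 * x3' + x1 * x3' = a4 - 2 * s' * k' - a1 * k' - a3 * s'" for s' k' x3'
        proof -
          have "s' * (2 * y1 + a1 * x1 + a3) = 3 * x1^2 + 2 * a2 * x1 + a4 - a1 * y1"
            using that by (rule tangent_slope)
          with s nz show ?thesis by (metis mult_cancel_right)
        qed
        with 1 2 k show ?thesis
          unfolding True[symmetric] y[symmetric] by blast
      next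
        case False
        have s: "s * (x1 - x2) = y1 - y2" using False by (simp add: s_def)
        have 0: "y2 = s * x2 + k" using s k by Groebner_Basis.algebra
        have x3: "x1 + x2 + x3 = s^2 + a1 * s - a2" by (simp add: x3_def)
        \<comment> \<open>The difference of the curve equations at the two points carries the factor
          x1 - x2, which is then cancelled.\<close>
        have "(x1 - x2) * (x1 * x2 + x1 * x3 + x2 * x3) = (x1 - x2) * (a4 - 2 * s * k - a1 * k - a3 * s)"
          using k 0 x3 P Q by Groebner_Basis.algebra
        with False have 1: "x1 * x2 + x1 * x3 + x2 * x3 = a4 - 2 * s * k - a1 * k - a3 * s" by simp
        have 2: "x1 * x2 * x3 = k^2 + a3 * k - a6"
          using 1 k x3 P by Groebner_Basis.algebra
        have "s' = s" if "y1 = s' * x1 + k'" "y2 = s' * x2 + k'" for s' k'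
        proof -
          have "s' * (x1 - x2) = y1 - y2" using that by Groebner_Basis.algebra
          with s False show ?thesis by (metis mult_cancel_right right_minus_eq)
        qed
        with 0 1 2 show ?thesis by blast
      qed
      have sum: "x1 + x2 + x3 = s^2 + a1 * s - a2" by (simp add: x3_def)
      have y2: "y2 = s * x2 + k"
        and sum2: "x1 * x2 + x1 * x3 + x2 * x3 = a4 - 2 * s * k - a1 * k - a3 * s"
        and prod: "x1 * x2 * x3 = k^2 + a3 * k - a6"
        using main by blast+
      have "y3^2 + a1 * x3 * y3 + a3 * y3 = x3^3 + a2 * x3^2 + a4 * x3 + a6"
        using y3_def sum sum2 prod by Groebner_Basis.algebra
      then have P3: "(x3, y3) \<in> affine_points E" by (simp add: affine_points_def E)
      show ?thesis
      proof (intro ex1I[of _ "Some (x3, y3)"] conjI)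
        show "Some (x3, y3) \<in> cpoints E" using P3 by (simp add: cpoints_def)
        show "collinear E P Q (Some (x3, y3))"
          unfolding 4(1,2) E collinear.simps using k y2 y3_def sum sum2 prod by blast
        fix R assume R: "R \<in> cpoints E \<and> collinear E P Q R"
        show "R = Some (x3, y3)"
        proof (cases R)
          case None
          with R False show ?thesis by (simp add: 4 E)
        next
          case (Some p)
          obtain x y where p: "p = (x, y)" by (cases p)
          from R obtain s' k' where *: "y1 = s' * x1 + k'" "y2 = s' * x2 + k'"
             "y = s' * x + k'" "x1 + x2 + x = s'^2 + a1 * s' - a2" 
             "x1 * x2 + x1 * x + x2 * x = a4 - 2 * s' * k' - a1 * k' - a3 * s'"
            by (auto simp: Some p 4 E)
          with main have "s' = s" by blast
          have "x = x3" using *(4) sum unfolding \<open>s' = s\<close> by (metis add_left_cancel)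
          moreover have "k' = k" using *(1) k unfolding \<open>s' = s\<close> by simp
          ultimately show ?thesis using *(3) \<open>s' = s\<close> by (simp add: Some p y3_def)
        qed
      qed
    qed
  qed
qed

text \<open>Collinear triples of points correspond to pairs of points, so their number is divisible by 3;
  hence so is the number of triples fixed by rotation, that is, of flexes.\<close>

lemma ex_affine_flex:
  fixes E :: "'a::{field,finite} weierstrass"
  assumes "affine_smooth E" "3 dvd card (points E)"
  shows "\<exists>x y. collinear E (Some (x, y)) (Some (x, y)) (Some (x, y))"
proof -
  define S where "S = {(P, Q, R). P \<in> cpoints E \<and> Q \<in> cpoints E \<and> R \<in> cpoints E \<and> collinear E P Q R}"
  define \<rho> :: "_ \<Rightarrow> ('a \<times> 'a) option \<times> ('a \<times> 'a) option \<times> ('a \<times> 'a) option" where "\<rho> = (\<lambda>(P, Q, R). (Q, R, P))"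
  have "card (cpoints E) = card (points E)"
    by (simp add: cpoints_def card_points card_image)
  moreover have "bij_betw (\<lambda>(P, Q, R). (P, Q)) S (cpoints E \<times> cpoints E)"
    unfolding bij_betw_def
  proof
    show "inj_on (\<lambda>(P, Q, R). (P, Q)) S"
      using ex1_collinear[OF assms(1)] by (auto simp: inj_on_def S_def)
    show "(\<lambda>(P, Q, R). (P, Q)) ` S = cpoints E \<times> cpoints E"
      using ex1_collinear[OF assms(1)] by (force simp: S_def image_iff)
  qed
  then have "card S = card (cpoints E) * card (cpoints E)"
    by (simp add: bij_betw_same_card card_cartesian_product)
  moreover have "[card S = card {T \<in> S. \<rho> T = T}] (mod 3)"
    by (rule card_cong_card_fixpoints_mod_3) (auto simp: \<rho>_def S_def dest: collinear_rotate)
  ultimately have "[card (points E) * card (points E) = card {T \<in> S. \<rho> T = T}] (mod 3)"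
    by simp
  then have "3 dvd card {T \<in> S. \<rho> T = T}"
    using assms(2) cong_dvd_iff dvd_mult by blast
  \<comment> \<open>A single fixed triple would give cardinality 1, which 3 does not divide.\<close>
  then have "{T \<in> S. \<rho> T = T} \<noteq> {(None, None, None)}" by force
  moreover have "(None, None, None) \<in> {T \<in> S. \<rho> T = T}"
    by (auto simp: S_def \<rho>_def cpoints_def)
  ultimately obtain T where T: "T \<in> S" "\<rho> T = T" "T \<noteq> (None, None, None)" by blast
  obtain P Q R where PQR: "T = (P, Q, R)" by (rule prod_cases3)
  have "(Q, R, P) = T"
    using T(2) by (simp only: PQR \<rho>_def prod.case)
  from arg_cong[OF this, of fst] arg_cong[OF this, of "\<lambda>t. snd (snd t)"]
  have "Q = P" "P = R" unfolding PQR by (simp_all only: fst_conv snd_conv)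
  then have "T = (P, P, P)" unfolding PQR by blast
  with T(1,3) have "collinear E P P P" "P \<noteq> None" by (auto simp: S_def)
  then show ?thesis by (cases P) auto
qed

section \<open>Polynomials over algebraically closed fields\<close>

text \<open>As in Euclid's argument: the product of all x - a, increased by 1, would be a
  nonconstant polynomial without roots.\<close>

lemma infinite_UNIV_alg_closed_field: "infinite (UNIV :: 'k::alg_closed_field set)"
proof
  assume fin: "finite (UNIV :: 'k set)"
  define p :: "'k poly" where "p = (\<Prod>a\<in>UNIV. [:- a, 1:])"
  have "Polynomial.degree p = card (UNIV :: 'k set)"
    by (simp add: p_def degree_prod_eq_sum_degree)
  with fin have "0 < Polynomial.degree (p + 1)"
    by (simp add: degree_add_eq_left card_gt_0_iff)
  then obtain x where "poly (p + 1) x = 0"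
    using alg_closed_imp_poly_has_root by blast
  moreover have "poly p x = 0"
    using fin by (auto simp: p_def poly_prod prod_zero_iff)
  ultimately show False by simp
qed

lemma poly_eq_0_if_all_roots:
  fixes p :: "'k::alg_closed_field poly"
  assumes "\<And>x. poly p x = 0"
  shows "p = 0"
  using assms poly_roots_finite[of p] infinite_UNIV_alg_closed_field by auto

lemma degree_le_1_imp_eq:
  assumes "Polynomial.degree p \<le> 1"
  shows "p = [:Polynomial.coeff p 0, Polynomial.coeff p 1:]"
  using assms by (intro poly_eqI) (auto simp: coeff_pCons coeff_eq_0 split: nat.split)

section \<open>Regular functions on an affine Weierstrass curve\<close>

text \<open>The term \<open>h\<close> is kept because the square cannot be completed in
  characteristic 2. The two degree conditions are what gives x and y the weights 2 and 3.\<close>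

locale cubic_curve =
  fixes h f :: "'k::alg_closed_field poly"
  assumes degree_h: "Polynomial.degree h \<le> 1" and degree_f: "Polynomial.degree f = 3"
begin

definition V :: "('k \<times> 'k) set" where
  "V = {(x, y). y^2 + poly h x * y = poly f x}"

text \<open>The coordinate ring of the curve is free over \<open>k[x]\<close> with basis \<open>1, y\<close>; \<open>nrm\<close> is its norm,
  whose degree is the pole order at infinity.\<close>

definition rep :: "('k \<times> 'k \<Rightarrow> 'k) \<Rightarrow> 'k poly \<Rightarrow> 'k poly \<Rightarrow> bool" where
  "rep u F G \<longleftrightarrow> (\<forall>(x, y) \<in> V. u (x, y) = poly F x + y * poly G x)"

definition regular :: "('k \<times> 'k \<Rightarrow> 'k) \<Rightarrow> bool" where
  "regular u \<longleftrightarrow> (\<exists>F G. rep u F G)"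

definition nrm :: "'k poly \<Rightarrow> 'k poly \<Rightarrow> 'k poly" where
  "nrm F G = F^2 - h * F * G - f * G^2"

definition pole :: "('k \<times> 'k \<Rightarrow> 'k) \<Rightarrow> nat \<Rightarrow> bool" where
  "pole u n \<longleftrightarrow> (\<exists>F G. rep u F G \<and> (F \<noteq> 0 \<or> G \<noteq> 0) \<and> Polynomial.degree (nrm F G) = n)"

text \<open>The weights are 2 for x and 3 for y. The case \<open>G = 0\<close> is separate because
  the zero polynomial has degree 0, so that the second entry of the maximum would contribute
  3.\<close>

definition wdeg :: "'k poly \<Rightarrow> 'k poly \<Rightarrow> nat" where
  "wdeg F G = (if G = 0 then 2 * Polynomial.degree F else max (2 * Polynomial.degree F) (2 * Polynomial.degree G + 3))"

lemma ex_point: "\<exists>y. (x, y) \<in> V"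
proof -
  have "0 < Polynomial.degree [:- poly f x, poly h x, 1:]" by simp
  then obtain y where "poly [:- poly f x, poly h x, 1:] y = 0"
    using alg_closed_imp_poly_has_root by blast
  then have "(x, y) \<in> V"
    by (simp add: V_def algebra_simps power2_eq_square)
  then show ?thesis ..
qed

text \<open>F^2 has even and f G^2 odd degree, so they cannot cancel; the degree of h F G lies
  strictly below the larger of the two.\<close>

lemma degree_nrm:
  assumes "F \<noteq> 0 \<or> G \<noteq> 0"
  shows "Polynomial.degree (nrm F G) = wdeg F G"
    and "nrm F G \<noteq> 0"
proof -
  let ?m = "Polynomial.degree F" and ?n = "Polynomial.degree G"
  have f0: "f \<noteq> 0" using degree_f by auto
  have F2: "Polynomial.degree (F^2) = 2 * ?m"
    by (cases "F = 0") (simp_all add: degree_power_eq)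
  have hFG: "Polynomial.degree (h * F * G) \<le> 1 + ?m + ?n"
    using degree_mult_le[of "h * F" G] degree_mult_le[of h F] degree_h by linarith
  have deg: "Polynomial.degree (nrm F G) = (if G = 0 then 2 * ?m else max (2 * ?m) (2 * ?n + 3))"
  proof (cases "G = 0")
    case True
    then show ?thesis using F2 by (simp add: nrm_def)
  next
    case False
    have fG: "Polynomial.degree (f * G^2) = 2 * ?n + 3"
      using False f0 by (simp add: degree_mult_eq degree_power_eq degree_f)
    show ?thesis
    proof (cases "2 * ?m < 2 * ?n + 3")
      case True
      have "Polynomial.degree (F^2 - h * F * G) \<le> 2 * ?n + 2"
        using True F2 hFG by (intro degree_diff_le) auto
      then have "Polynomial.degree (F^2 - h * F * G + - (f * G^2)) = Polynomial.degree (- (f * G^2))"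
        using fG by (intro degree_add_eq_right) simp
      then show ?thesis using True False fG by (simp add: nrm_def)
    next
      case le: False
      then have "2 * ?n + 3 < 2 * ?m" by presburger
      then have "Polynomial.degree (h * F * G + f * G^2) < Polynomial.degree (F^2)"
        using F2 hFG fG by (intro le_less_trans[OF degree_add_le_max]) auto
      then have "Polynomial.degree (F^2 + - (h * F * G + f * G^2)) = Polynomial.degree (F^2)"
        by (intro degree_add_eq_left) (simp only: degree_minus)
      moreover have "F^2 + - (h * F * G + f * G^2) = nrm F G" by (simp add: nrm_def)
      ultimately show ?thesis using le False F2 by simp
    qed
  qed
  then show "Polynomial.degree (nrm F G) = wdeg F G" by (simp add: wdeg_def)
  show "nrm F G \<noteq> 0"
  proof (cases "G = 0")
    case True
    then show ?thesis using assms by (simp add: nrm_def)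
  next
    case False
    with deg have "Polynomial.degree (nrm F G) \<noteq> 0" by simp
    then show ?thesis by auto
  qed
qed

text \<open>The second factor is the conjugate: the value at the other point (x, - h(x) - y) over
  the same x.\<close>

lemma poly_nrm:
  assumes "(x, y) \<in> V"
  shows "poly (nrm F G) x = (poly F x + y * poly G x) * (poly F x - poly h x * poly G x - y * poly G x)"
proof -
  have f: "poly f x = y^2 + poly h x * y" using assms by (simp add: V_def)
  show ?thesis unfolding nrm_def poly_diff poly_mult poly_power f by (simp add: algebra_simps power2_eq_square)
qed

lemma repD: "rep u F G \<Longrightarrow> (x, y) \<in> V \<Longrightarrow> u (x, y) = poly F x + y * poly G x"
  by (auto simp: rep_def)

text \<open>The norm of the difference vanishes at every x, since a point of the curve lies over
  each x; over an infinite field it is therefore 0.\<close>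

lemma rep_unique:
  assumes "rep u F G" "rep u F' G'"
  shows "F = F' \<and> G = G'"
proof (rule ccontr)
  assume "\<not> (F = F' \<and> G = G')"
  then have "nrm (F - F') (G - G') \<noteq> 0"
    by (intro degree_nrm(2)) auto
  moreover have "poly (nrm (F - F') (G - G')) x = 0" for x
  proof -
    obtain y where y: "(x, y) \<in> V" using ex_point by blast
    then have "poly F x + y * poly G x = poly F' x + y * poly G' x"
      using assms by (metis repD)
    then have "poly (F - F') x + y * poly (G - G') x = 0" by (simp add: algebra_simps)
    then show ?thesis using y by (simp only: poly_nrm mult_zero_left)
  qed
  ultimately show False using poly_eq_0_if_all_roots by blast
qed

lemma rep_cong: "(\<And>P. P \<in> V \<Longrightarrow> u P = v P) \<Longrightarrow> rep u F G \<longleftrightarrow> rep v F G"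
  by (force simp: rep_def)

lemma rep_const: "rep (\<lambda>P. c) [:c:] 0"
  by (simp add: rep_def)

lemma rep_fst: "rep fst [:0, 1:] 0"
  by (simp add: rep_def)

lemma rep_snd: "rep snd 0 1"
  by (simp add: rep_def)

lemma rep_uminus: "rep u F G \<Longrightarrow> rep (\<lambda>P. - u P) (- F) (- G)"
  by (auto simp: rep_def)

lemma rep_add: "rep u F G \<Longrightarrow> rep v F' G' \<Longrightarrow> rep (\<lambda>P. u P + v P) (F + F') (G + G')"
  by (fastforce simp: rep_def algebra_simps)

lemma rep_mult:
  assumes "rep u F G" "rep v F' G'"
  shows "rep (\<lambda>P. u P * v P) (F * F' + f * G * G') (F * G' + G * F' - h * G * G')"
  unfolding rep_def
proof (intro ballI, clarify)
  fix x y assume xy: "(x, y) \<in> V"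
  then have f: "poly f x = y^2 + poly h x * y" by (simp add: V_def)
  show "u (x, y) * v (x, y) = poly (F * F' + f * G * G') x + y * poly (F * G' + G * F' - h * G * G') x"
    by (simp add: assms[THEN repD, OF xy] f algebra_simps power2_eq_square)
qed

text \<open>Multiplicativity of the norm, the source of the additivity of pole orders.\<close>

lemma nrm_mult: "nrm (F * F' + f * G * G') (F * G' + G * F' - h * G * G') = nrm F G * nrm F' G'"
  unfolding nrm_def by (simp add: algebra_simps power2_eq_square)

section \<open>The ring of regular functions\<close>

lemma regular_cong: "(\<And>P. P \<in> V \<Longrightarrow> u P = v P) \<Longrightarrow> regular u \<longleftrightarrow> regular v"
  using rep_cong unfolding regular_def by blast

lemma regular_const: "regular (\<lambda>P. c)"
  and regular_fst: "regular fst"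
  and regular_snd: "regular snd"
  and regular_add: "regular u \<Longrightarrow> regular v \<Longrightarrow> regular (\<lambda>P. u P + v P)"
  and regular_mult: "regular u \<Longrightarrow> regular v \<Longrightarrow> regular (\<lambda>P. u P * v P)"
  unfolding regular_def using rep_const rep_fst rep_snd rep_add rep_mult by blast+

lemma regular_poly: "regular u \<Longrightarrow> regular (\<lambda>P. poly F (u P))"
  by (induction F) (auto intro!: regular_const regular_add regular_mult)

lemma regular_power: "regular u \<Longrightarrow> regular (\<lambda>P. u P ^ n)"
  by (induction n) (auto intro!: regular_const regular_mult)

lemma regular_sum: "(\<And>i. i \<in> I \<Longrightarrow> regular (u i)) \<Longrightarrow> regular (\<lambda>P. \<Sum>i\<in>I. u i P)"
  by (induction I rule: infinite_finite_induct) (auto intro!: regular_const regular_add)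

text \<open>The polynomials in \<open>x\<close> that clear the denominators of \<open>u\<close> form an ideal without common zero:
  over a given \<open>x\<close> lie at most two points, some admissible denominator vanishes at neither,
  and so does its norm.\<close>

lemma regular_if_locally_fraction:
  assumes "\<And>P. P \<in> V \<Longrightarrow> \<exists>d v. regular d \<and> regular v \<and> d P \<noteq> 0 \<and> (\<forall>Q\<in>V. d Q * u Q = v Q)"
  shows "regular u"
proof -
  define D where "D = {d. regular d \<and> regular (\<lambda>Q. d Q * u Q)}"
  have D_add: "(\<lambda>Q. d Q + e Q) \<in> D" if "d \<in> D" "e \<in> D" for d e
    using that by (auto simp: D_def distrib_right intro: regular_add)
  have D_mult: "(\<lambda>Q. e Q * d Q) \<in> D" if "d \<in> D" "regular e" for d e
    using that by (auto simp: D_def mult.assoc intro: regular_mult)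
  have D_point: "\<exists>d\<in>D. d P \<noteq> 0" if P: "P \<in> V" for P
  proof -
    obtain d v where dv: "regular d" "regular v" "d P \<noteq> 0" "\<forall>Q\<in>V. d Q * u Q = v Q"
      using assms[OF P] by blast
    then have "regular (\<lambda>Q. d Q * u Q)" using regular_cong[of "\<lambda>Q. d Q * u Q" v] by auto
    with dv show ?thesis by (auto simp: D_def)
  qed
  define I where "I = {H. (\<lambda>(x, y). poly H x) \<in> D}"
  have I_root: "\<exists>H\<in>I. poly H x \<noteq> 0" for x
  proof -
    obtain y where y: "(x, y) \<in> V" using ex_point by blast
    define y' where "y' = - poly h x - y"
    have y': "(x, y') \<in> V"
      using y by (simp add: V_def y'_def algebra_simps power2_eq_square)
    obtain d where d: "d \<in> D" "d (x, y) \<noteq> 0" "d (x, y') \<noteq> 0"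
    proof -
      obtain d1 d2 where 12: "d1 \<in> D" "d1 (x, y) \<noteq> 0" "d2 \<in> D" "d2 (x, y') \<noteq> 0"
        using D_point y y' by blast
      consider "d1 (x, y') \<noteq> 0" | "d2 (x, y) \<noteq> 0" | "d1 (x, y') = 0" "d2 (x, y) = 0" by blast
      then show thesis
      proof cases
        case 3
        \<comment> \<open>Each of \<open>d1\<close> and \<open>d2\<close> vanishes at the other's
          point, so the sum vanishes at neither.\<close>
        show thesis by (rule that[of "\<lambda>Q. d1 Q + d2 Q"]) (use 3 12 D_add in auto)
      qed (use 12 that in auto)
    qed
    then obtain F G where FG: "rep d F G" by (auto simp: D_def regular_def)
    \<comment> \<open>\<open>e\<close> is the conjugate of \<open>d\<close>: the product is the
      norm, a polynomial in x alone, and it is still a denominator of \<open>u\<close>.\<close>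
    define e where "e = (\<lambda>(x, y). poly F x - poly h x * poly G x - y * poly G x)"
    have "rep e (F - h * G) (- G)" by (simp add: rep_def e_def)
    then have "(\<lambda>Q. e Q * d Q) \<in> D" using D_mult d(1) by (auto simp: regular_def)
    moreover have nrm: "poly (nrm F G) x = e (x, y) * d (x, y)" if "(x, y) \<in> V" for x y
      by (simp add: poly_nrm[OF that] e_def repD[OF FG that])
    ultimately have "nrm F G \<in> I"
      using regular_cong[of "\<lambda>Q. e Q * d Q" "\<lambda>(x, y). poly (nrm F G) x"]
        regular_cong[of "\<lambda>Q. e Q * d Q * u Q" "\<lambda>Q. (case Q of (x, y) \<Rightarrow> poly (nrm F G) x) * u Q"]
      by (auto simp: I_def D_def)
    moreover have "e (x, y) = d (x, y')"
      by (simp add: e_def repD[OF FG y']) (simp add: y'_def algebra_simps)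
    ultimately show ?thesis using nrm[OF y] d(2,3) by (metis mult_eq_0_iff)
  qed
  have reg_poly: "regular (\<lambda>(x, y). poly H x)" for H
    using regular_poly[OF regular_fst, of H] by (simp add: case_prod_unfold)
  have I_add: "H + K \<in> I" if "H \<in> I" "K \<in> I" for H K
    using D_add[of "\<lambda>(x, y). poly H x" "\<lambda>(x, y). poly K x"] that
    by (simp add: I_def case_prod_unfold)
  have I_mult: "K * H \<in> I" if "H \<in> I" for H K
    using D_mult[OF _ reg_poly, of "\<lambda>(x, y). poly H x" K] that
    by (simp add: I_def case_prod_unfold)
  \<comment> \<open>An element of least degree divides all others; if it were nonconstant, its root
    would be a common zero of the ideal.\<close>
  obtain H0 where "H0 \<in> I" "H0 \<noteq> 0" using I_root[of 0] by (metis poly_0)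
  then obtain H where H: "H \<in> I" "H \<noteq> 0"
    and min: "\<And>K. K \<in> I \<Longrightarrow> K \<noteq> 0 \<Longrightarrow> Polynomial.degree H \<le> Polynomial.degree K"
    using ex_has_least_nat[of "\<lambda>H. H \<in> I \<and> H \<noteq> 0" H0 Polynomial.degree] by blast
  have "Polynomial.degree H = 0"
  proof (rule ccontr)
    assume "Polynomial.degree H \<noteq> 0"
    then obtain x where x: "poly H x = 0" using alg_closed_imp_poly_has_root by blast
    obtain K where K: "K \<in> I" "poly K x \<noteq> 0" using I_root by blast
    have "K mod H = K + - (K div H) * H"
      by (simp add: minus_div_mult_eq_mod[symmetric])
    then have "K mod H \<in> I" using I_add I_mult K(1) H(1) by presburger
    then have "K mod H = 0"
      using min[of "K mod H"] degree_mod_less[of H K] H(2) by (meson linorder_not_le)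
    then have "K = K div H * H" by (metis add.right_neutral div_mult_mod_eq)
    then show False using x K(2) by (metis mult_zero_right poly_mult)
  qed
  then obtain c where c: "H = [:c:]" by (rule degree_eq_zeroE)
  with H have "c \<noteq> 0" "regular (\<lambda>Q. c * u Q)" by (auto simp: I_def D_def case_prod_unfold)
  with regular_mult[OF regular_const[of "1 / c"] this(2)] show ?thesis by simp
qed

section \<open>Pole orders at infinity\<close>

lemma pole_iff:
  "pole u n \<longleftrightarrow> (\<exists>F G. rep u F G \<and> (F \<noteq> 0 \<or> G \<noteq> 0) \<and> n = wdeg F G)"
  unfolding pole_def using degree_nrm(1) by blast

lemma pole_cong: "(\<And>P. P \<in> V \<Longrightarrow> u P = v P) \<Longrightarrow> pole u n \<longleftrightarrow> pole v n"
  using rep_cong unfolding pole_def by blast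

lemma pole_unique: "pole u m \<Longrightarrow> pole u n \<Longrightarrow> m = n"
  unfolding pole_def using rep_unique by blast

lemma regular_cases:
  assumes "regular u"
  obtains "\<And>P. P \<in> V \<Longrightarrow> u P = 0" | n where "pole u n"
proof -
  obtain F G where FG: "rep u F G" using assms by (auto simp: regular_def)
  show thesis
  proof (cases "F = 0 \<and> G = 0")
    case True
    then show ?thesis using FG by (intro that(1)) (auto simp: rep_def)
  next
    case False
    then show ?thesis using FG by (intro that(2)) (auto simp: pole_def)
  qed
qed

lemma pole_imp_neq_0:
  assumes "pole u n"
  shows "\<exists>P\<in>V. u P \<noteq> 0"
proof (rule ccontr)
  assume "\<not> (\<exists>P\<in>V. u P \<noteq> 0)"
  then have "rep u 0 0" by (auto simp: rep_def)
  with assms show False unfolding pole_def using rep_unique by blast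
qed

lemma pole_imp_regular: "pole u n \<Longrightarrow> regular u"
  by (auto simp: pole_def regular_def)

lemma poleI: "rep u F G \<Longrightarrow> F \<noteq> 0 \<or> G \<noteq> 0 \<Longrightarrow> pole u (wdeg F G)"
  unfolding pole_iff by blast

lemma poleE:
  assumes "pole u n"
  obtains F G where "rep u F G" "F \<noteq> 0 \<or> G \<noteq> 0" "n = wdeg F G"
  using assms unfolding pole_iff by blast

lemma pole_const: "c \<noteq> 0 \<Longrightarrow> pole (\<lambda>P. c) 0"
  using poleI[OF rep_const[of c]] by (simp add: wdeg_def)

lemma pole_fst: "pole fst 2"
  using poleI[OF rep_fst] by (simp add: wdeg_def)

lemma pole_snd: "pole snd 3"
  using poleI[OF rep_snd] by (simp add: wdeg_def)

lemma wdeg_uminus: "wdeg (- F) (- G) = wdeg F G"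
  by (simp add: wdeg_def)

lemma wdeg_add_le: "wdeg (F + F') (G + G') \<le> max (wdeg F G) (wdeg F' G')"
proof -
  have "2 * Polynomial.degree F \<le> wdeg F G" "2 * Polynomial.degree F' \<le> wdeg F' G'"
    by (simp_all add: wdeg_def)
  then have "2 * Polynomial.degree (F + F') \<le> max (wdeg F G) (wdeg F' G')"
    using degree_add_le_max[of F F'] by linarith
  moreover have "2 * Polynomial.degree (G + G') + 3 \<le> max (wdeg F G) (wdeg F' G')" if "G + G' \<noteq> 0"
  proof -
    have "2 * Polynomial.degree G + 3 \<le> wdeg F G" if "G \<noteq> 0" using that by (simp add: wdeg_def)
    moreover have "2 * Polynomial.degree G' + 3 \<le> wdeg F' G'" if "G' \<noteq> 0" using that by (simp add: wdeg_def)
    ultimately show ?thesis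
      using degree_add_le_max[of G G'] \<open>G + G' \<noteq> 0\<close> by (cases "G = 0"; cases "G' = 0") auto
  qed
  ultimately show ?thesis by (simp add: wdeg_def[of "F + F'"])
qed

lemma pole_uminus:
  assumes "pole u n"
  shows "pole (\<lambda>P. - u P) n"
proof -
  obtain F G where "rep u F G" "F \<noteq> 0 \<or> G \<noteq> 0" "n = wdeg F G" using assms by (rule poleE)
  with poleI[OF rep_uminus] show ?thesis by (metis neg_equal_0_iff_equal wdeg_uminus)
qed

lemma pole_mult:
  assumes "pole u m" "pole v n"
  shows "pole (\<lambda>P. u P * v P) (m + n)"
proof -
  obtain F G where 1: "rep u F G" "F \<noteq> 0 \<or> G \<noteq> 0" "Polynomial.degree (nrm F G) = m"
    using assms(1) by (auto simp: pole_def)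
  obtain F' G' where 2: "rep v F' G'" "F' \<noteq> 0 \<or> G' \<noteq> 0" "Polynomial.degree (nrm F' G') = n"
    using assms(2) by (auto simp: pole_def)
  let ?F = "F * F' + f * G * G'" and ?G = "F * G' + G * F' - h * G * G'"
  have "nrm F G \<noteq> 0" "nrm F' G' \<noteq> 0" using degree_nrm(2) 1 2 by blast+
  then have "nrm ?F ?G \<noteq> 0" "Polynomial.degree (nrm ?F ?G) = m + n"
    unfolding nrm_mult using 1 2 by (simp_all add: degree_mult_eq)
  moreover have "nrm 0 0 = 0" by (simp add: nrm_def)
  with \<open>nrm ?F ?G \<noteq> 0\<close> have "?F \<noteq> 0 \<or> ?G \<noteq> 0" by metis
  ultimately show ?thesis unfolding pole_def using rep_mult[OF 1(1) 2(1)] by blast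
qed

lemma pole_add_le:
  assumes "pole u m" "pole v n" "pole (\<lambda>P. u P + v P) k"
  shows "k \<le> max m n"
proof -
  obtain F G where 1: "rep u F G" "m = wdeg F G" using assms(1) by (rule poleE)
  obtain F' G' where 2: "rep v F' G'" "n = wdeg F' G'" using assms(2) by (rule poleE)
  obtain F'' G'' where 3: "rep (\<lambda>P. u P + v P) F'' G''" "k = wdeg F'' G''" using assms(3) by (rule poleE)
  have "F'' = F + F' \<and> G'' = G + G'" using rep_unique[OF 3(1) rep_add[OF 1(1) 2(1)]] .
  with 1 2 3 wdeg_add_le show ?thesis by simp
qed

text \<open>The order of u + v is at most n, and it cannot be smaller, since v = (u + v) - u has
  order n > m.\<close>

lemma pole_add:
  assumes "pole u m" "pole v n" "m < n"
  shows "pole (\<lambda>P. u P + v P) n"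
  using regular_add[OF assms(1,2)[THEN pole_imp_regular]]
proof (cases rule: regular_cases)
  case 1
  then have "pole (\<lambda>P. - u P) n"
    using assms(2) by (subst pole_cong[of _ v]) (auto simp: eq_neg_iff_add_eq_0 neg_eq_iff_add_eq_0)
  then show ?thesis using pole_unique[OF pole_uminus[OF assms(1)]] assms(3) by blast
next
  case (2 k)
  have "pole (\<lambda>P. (u P + v P) + - u P) n" using assms(2) by simp
  from pole_add_le[OF 2 pole_uminus[OF assms(1)] this] pole_add_le[OF assms(1,2) 2] assms(3)
  have "k = n" by simp
  with 2 show ?thesis by simp
qed

text \<open>Horner's scheme: as m > 0, adding the constant coefficient never changes the order of a
  nonconstant partial result.\<close>

lemma pole_poly:
  assumes "pole u m" "0 < m" "F \<noteq> 0"
  shows "pole (\<lambda>P. poly F (u P)) (Polynomial.degree F * m)"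
  using assms(3)
proof (induction F)
  case (pCons a F)
  show ?case
  proof (cases "F = 0")
    case True
    with pCons show ?thesis by (simp add: pole_const)
  next
    case False
    then have pole: "pole (\<lambda>P. u P * poly F (u P)) (m + Polynomial.degree F * m)"
      using pole_mult[OF assms(1)] pCons.IH by blast
    show ?thesis
    proof (cases "a = 0")
      case True
      with \<open>F \<noteq> 0\<close> pole show ?thesis by simp
    next
      case False
      have "pole (\<lambda>P. a + u P * poly F (u P)) (m + Polynomial.degree F * m)"
        using assms(2) by (intro pole_add[OF pole_const pole] False) simp
      with \<open>F \<noteq> 0\<close> show ?thesis by simp
    qed
  qed
qed simp

text \<open>With \<open>pole_3E\<close>, an explicit form of the Riemann-Roch spaces of twice and
  three times the point at infinity.\<close>

lemma pole_2E:
  assumes "pole u 2"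
  obtains \<alpha> \<beta> where "\<alpha> \<noteq> 0" "\<And>x y. (x, y) \<in> V \<Longrightarrow> u (x, y) = \<alpha> * x + \<beta>"
proof -
  obtain F G where FG: "rep u F G" "2 = wdeg F G"
    using assms by (rule poleE)
  then have "G = 0" "Polynomial.degree F = 1" by (auto simp: wdeg_def split: if_splits)
  moreover from this(2) obtain \<beta> \<alpha> where "F = [:\<beta>, \<alpha>:]" "\<alpha> \<noteq> 0"
    by (metis degree_le_1_imp_eq order_refl leading_coeff_0_iff degree_0 zero_neq_one)
  ultimately show thesis
    using FG(1) by (intro that[of \<alpha> \<beta>]) (auto simp: rep_def)
qed

lemma pole_3E:
  assumes "pole u 3"
  obtains \<gamma> \<delta> \<epsilon> where "\<gamma> \<noteq> 0" "\<And>x y. (x, y) \<in> V \<Longrightarrow> u (x, y) = \<gamma> * y + \<delta> * x + \<epsilon>"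
proof -
  obtain F G where FG: "rep u F G" "3 = wdeg F G"
    using assms by (rule poleE)
  have "G \<noteq> 0"
  proof
    assume "G = 0"
    with FG(2) have "3 = 2 * Polynomial.degree F" by (simp add: wdeg_def)
    then show False by presburger
  qed
  with FG(2) have "2 * Polynomial.degree G \<le> 0" "2 * Polynomial.degree F \<le> 3"
    unfolding wdeg_def by (auto simp: max_def split: if_splits)
  then have "Polynomial.degree G = 0" "Polynomial.degree F \<le> 1" by auto
  then obtain \<gamma> \<delta> \<epsilon> where "G = [:\<gamma>:]" "F = [:\<epsilon>, \<delta>:]"
    using degree_le_1_imp_eq degree_eq_zeroE by metis
  then show thesis
    using FG(1) \<open>G \<noteq> 0\<close> by (intro that[of \<gamma> \<delta> \<epsilon>]) (auto simp: rep_def algebra_simps)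
qed


lemma pole_0E:
  assumes "pole u 0"
  obtains c where "\<And>P. P \<in> V \<Longrightarrow> u P = c"
proof -
  obtain F G where FG: "rep u F G" "0 = wdeg F G"
    using assms by (rule poleE)
  then have "G = 0" "Polynomial.degree F = 0" by (auto simp: wdeg_def split: if_splits)
  moreover from this(2) obtain c where "F = [:c:]" by (rule degree_eq_zeroE)
  ultimately show thesis using FG(1) by (intro that[of c]) (auto simp: rep_def)
qed

text \<open>By the equation, \<open>u\<close> and \<open>v\<close> have poles of order \<open>2 k\<close> and \<open>3 k\<close> for some \<open>k\<close>;
  then \<open>k\<close> divides the pole orders 2 and 3 of the coordinate functions.\<close>

lemma pole_coordinates:
  assumes h': "Polynomial.degree h' \<le> 1" and f': "Polynomial.degree f' = 3"
    and u: "regular u" and v: "regular v"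
    and eq: "\<And>P. P \<in> V \<Longrightarrow> v P ^ 2 + poly h' (u P) * v P = poly f' (u P)"
    and x: "\<And>P. P \<in> V \<Longrightarrow> fst P = poly A (u P) + v P * poly B (u P)"
    and y: "\<And>P. P \<in> V \<Longrightarrow> snd P = poly C (u P) + v P * poly D (u P)"
  shows "pole u 2" and "pole v 3"
proof -
  \<comment> \<open>If u were a constant c, then D(c) x - B(c) y would be constant on the curve.
    Uniqueness of representations forces B(c) = 0, and x itself would be constant.\<close>
  have nonconst: "\<not> (\<forall>P\<in>V. u P = c)" for c
  proof
    assume u: "\<forall>P\<in>V. u P = c"
    have 1: "rep (\<lambda>P. poly D c * fst P + - poly B c * snd P) [:0, poly D c:] [:- poly B c:]"
      by (simp add: rep_def algebra_simps)
    have "poly D c * fst P + - poly B c * snd P = poly D c * poly A c - poly B c * poly C c" if "P \<in> V" for P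
      unfolding x[OF that] y[OF that] using u that by (simp add: algebra_simps)
    then have 2: "rep (\<lambda>P. poly D c * fst P + - poly B c * snd P) [:poly D c * poly A c - poly B c * poly C c:] 0"
      by (auto simp: rep_def)
    have "poly B c = 0" using rep_unique[OF 1 2] by simp
    then have "rep fst [:poly A c:] 0" using u x by (force simp: rep_def)
    with rep_unique[OF rep_fst this] show False by simp
  qed
  from u obtain m where m: "pole u m"
    using nonconst[of 0] by (cases rule: regular_cases) auto
  have "m > 0" using nonconst pole_0E m by (metis gr0I)
  have "f' \<noteq> 0" using f' by auto
  then have fu: "pole (\<lambda>P. poly f' (u P)) (3 * m)"
    using pole_poly[OF m \<open>m > 0\<close>, of f'] f' by simp
  \<comment> \<open>Up to sign, w is the conjugate of v in the target equation, so v w = f'(u) has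
    order 3 m.\<close>
  define w where "w = (\<lambda>P. v P + poly h' (u P))"
  have vw: "v P * w P = poly f' (u P)" if "P \<in> V" for P
    using eq[OF that] by (simp add: w_def algebra_simps power2_eq_square)
  obtain n where n: "pole v n"
    using v
  proof (cases rule: regular_cases)
    case 1
    then show ?thesis using pole_imp_neq_0[OF fu] vw by fastforce
  qed
  have "regular w" unfolding w_def by (intro regular_add regular_poly u v)
  then obtain l where l: "pole w l"
  proof (cases rule: regular_cases)
    case 1
    then show ?thesis using pole_imp_neq_0[OF fu] vw by fastforce
  qed
  have nl: "n + l = 3 * m"
  proof -
    have "pole (\<lambda>P. v P * w P) (n + l) \<longleftrightarrow> pole (\<lambda>P. poly f' (u P)) (n + l)"
      by (rule pole_cong) (rule vw)
    with pole_mult[OF n l] fu show ?thesis using pole_unique by blast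
  qed
  \<comment> \<open>If h' is nonzero, h'(u) has order at most m. Then n \<le> m would give l \<le> m
    and n + l < 3 m; so v dominates h'(u), and w has the order of v.\<close>
  have "n = l"
  proof (cases "h' = 0")
    case True
    then show ?thesis using n l pole_unique by (simp add: w_def)
  next
    case False
    have hu: "pole (\<lambda>P. poly h' (u P)) (Polynomial.degree h' * m)"
      using pole_poly[OF m \<open>m > 0\<close> False] .
    have le: "Polynomial.degree h' * m \<le> m" using h' by (cases "Polynomial.degree h'") auto
    have "n > m"
    proof (rule ccontr)
      assume "\<not> n > m"
      with le pole_add_le[OF n hu l[unfolded w_def]] have "l \<le> m" by linarith
      with nl \<open>\<not> n > m\<close> \<open>m > 0\<close> show False by linarith
    qed
    with le have "pole (\<lambda>P. poly h' (u P) + v P) n" by (intro pole_add[OF hu n]) linarith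
    then show ?thesis using l pole_unique by (simp add: w_def add.commute)
  qed
  then have "2 * n = 3 * m" using nl by simp
  \<comment> \<open>The common factor k is n - m, as 3 k - 2 k = k.\<close>
  then have "m = 2 * (n - m)" "n = 3 * (n - m)" by linarith+
  then obtain k where k: "m = 2 * k" "n = 3 * k" by blast
  have dvd: "k dvd j" if "pole (\<lambda>P. poly A (u P) + v P * poly B (u P)) j" for A B j
  proof -
    have A: "pole (\<lambda>P. poly A (u P)) (2 * Polynomial.degree A * k)" if "A \<noteq> 0"
      using pole_poly[OF m \<open>m > 0\<close> that] by (simp add: k mult_ac)
    have B: "pole (\<lambda>P. v P * poly B (u P)) ((3 + 2 * Polynomial.degree B) * k)" if "B \<noteq> 0"
      using pole_mult[OF n pole_poly[OF m \<open>m > 0\<close> that]] by (simp add: k algebra_simps)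
    \<comment> \<open>The multiples of k involved, 2 deg A and 3 + 2 deg B, differ in parity, so the
      two summands never have equal order.\<close>
    consider "A = 0" "B = 0" | "A = 0" "B \<noteq> 0" | "A \<noteq> 0" "B = 0"
      | "A \<noteq> 0" "B \<noteq> 0" "2 * Polynomial.degree A < 3 + 2 * Polynomial.degree B"
      | "A \<noteq> 0" "B \<noteq> 0" "3 + 2 * Polynomial.degree B < 2 * Polynomial.degree A"
      by (metis linorder_neqE_nat even_add even_mult_iff even_numeral odd_numeral)
    then show ?thesis
    proof cases
      case 1
      then show ?thesis using pole_imp_neq_0[OF that] by simp
    next
      case 2
      then have "j = (3 + 2 * Polynomial.degree B) * k" using that B pole_unique by simp
      then show ?thesis by simp
    next
      case 3
      then have "j = 2 * Polynomial.degree A * k" using that A pole_unique by simp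
      then show ?thesis by simp
    next
      case 4
      have "k > 0" using \<open>m > 0\<close> k by simp
      with 4(3) have "2 * Polynomial.degree A * k < (3 + 2 * Polynomial.degree B) * k" by (rule mult_strict_right_mono)
      from pole_unique[OF that pole_add[OF A B this]] 4 show ?thesis by simp
    next
      case 5
      have "k > 0" using \<open>m > 0\<close> k by simp
      with 5(3) have less: "(3 + 2 * Polynomial.degree B) * k < 2 * Polynomial.degree A * k" by (rule mult_strict_right_mono)
      have "pole (\<lambda>P. v P * poly B (u P) + poly A (u P)) j" using that by (simp only: add.commute)
      from pole_unique[OF this pole_add[OF B A less]] 5 show ?thesis by simp
    qed
  qed
  have "k dvd 2" using dvd[of A B 2] pole_fst pole_cong[of fst "\<lambda>P. poly A (u P) + v P * poly B (u P)" 2] x by simp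
  moreover have "k dvd 3" using dvd[of C D 3] pole_snd pole_cong[of snd "\<lambda>P. poly C (u P) + v P * poly D (u P)" 3] y by simp
  ultimately have "k dvd 3 - 2" by (rule dvd_diff_nat[rotated])
  then show "pole u 2" "pole v 3" using k m n by simp_all
qed

end

section \<open>Forms and morphisms\<close>

text \<open>Forms as functions: sums, products and compositions can be formed without carrying
  explicit coefficients.\<close>

definition is_form :: "nat \<Rightarrow> ('a::field alg_closure \<times> 'a alg_closure \<times> 'a alg_closure \<Rightarrow> 'a alg_closure) \<Rightarrow> bool" where
  "is_form d u \<longleftrightarrow> (\<exists>c. u = form d c)"

lemma is_form_homogeneous:
  assumes "is_form d u"
  shows "u (t * x, t * y, t * z) = t ^ d * u (x, y, z)"
proof -
  obtain c where u: "u = form d c" using assms by (auto simp: is_form_def)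
  have *: "to_ac (c i j) * (t * x) ^ i * (t * y) ^ j * (t * z) ^ (d - i - j)
      = t ^ d * (to_ac (c i j) * x ^ i * y ^ j * z ^ (d - i - j))" if "i \<le> d" "j \<le> d - i" for i j
  proof -
    have "t ^ d = t ^ i * t ^ j * t ^ (d - i - j)"
      using that by (simp flip: power_add)
    then show ?thesis by (simp add: power_mult_distrib mult_ac)
  qed
  show ?thesis
    unfolding u form.simps sum_distrib_left by (intro sum.cong refl *) simp_all
qed

lemma is_form_monomial: "is_form (i + j + k) (\<lambda>(x, y, z). to_ac a * x ^ i * y ^ j * z ^ k)"
proof -
  define c where "c = (\<lambda>i' j'. if i' = i \<and> j' = j then a else 0)"
  have "to_ac a * x ^ i * y ^ j * z ^ k = form (i + j + k) c (x, y, z)" (is "?M = _") for x y z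
  proof -
    have "to_ac (c i' j') * x ^ i' * y ^ j' * z ^ (i + j + k - i' - j')
        = (if i' = i then if j' = j then ?M else 0 else 0)" for i' j'
      by (auto simp: c_def)
    moreover have "(\<Sum>j'\<le>i + j + k - i'. if i' = i then if j' = j then ?M else 0 else 0)
        = (if i' = i then ?M else 0)" for i'
      by (auto simp: sum.delta)
    ultimately show ?thesis by (simp only: form.simps) (simp add: sum.delta)
  qed
  then have "(\<lambda>(x, y, z). to_ac a * x ^ i * y ^ j * z ^ k) = form (i + j + k) c"
    by auto
  then show ?thesis unfolding is_form_def by blast
qed

lemma is_form_0: "is_form d (\<lambda>p. 0)"
proof -
  have "(\<lambda>p. 0) = form d (\<lambda>i j. 0)" by auto
  then show ?thesis unfolding is_form_def by blast
qed

lemma is_form_add: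
  assumes "is_form d u" "is_form d v"
  shows "is_form d (\<lambda>p. u p + v p)"
proof -
  obtain c c' where "u = form d c" "v = form d c'" using assms by (auto simp: is_form_def)
  then have "(\<lambda>p. u p + v p) = form d (\<lambda>i j. c i j + c' i j)"
    by (auto simp: distrib_right sum.distrib)
  then show ?thesis unfolding is_form_def by blast
qed

lemma is_form_sum: "(\<And>i. i \<in> I \<Longrightarrow> is_form d (u i)) \<Longrightarrow> is_form d (\<lambda>p. \<Sum>i\<in>I. u i p)"
  by (induction I rule: infinite_finite_induct) (auto intro!: is_form_add is_form_0)

lemma is_form_mult:
  assumes "is_form d u" "is_form e v"
  shows "is_form (d + e) (\<lambda>p. u p * v p)"
proof -
  obtain c c' where u: "u = form d c" and v: "v = form e c'" using assms by (auto simp: is_form_def)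
  let ?m = "\<lambda>d c i j p. case p of (x, y, z) \<Rightarrow> to_ac (c i j) * x ^ i * y ^ j * z ^ (d - i - j)"
  have form: "form d c p = (\<Sum>i\<le>d. \<Sum>j\<le>d - i. ?m d c i j p)" for d p and c :: "nat \<Rightarrow> nat \<Rightarrow> 'a"
    by (cases p) simp
  have uv: "(\<lambda>p. u p * v p) = (\<lambda>p. \<Sum>i\<le>d. \<Sum>j\<le>d - i. \<Sum>i'\<le>e. \<Sum>j'\<le>e - i'. ?m d c i j p * ?m e c' i' j' p)"
    unfolding u v form sum_distrib_right by (simp only: sum_distrib_left)
  show ?thesis
    unfolding uv
  proof (intro is_form_sum)
    fix i j i' j' assume "i \<in> {..d}" "j \<in> {..d - i}" "i' \<in> {..e}" "j' \<in> {..e - i'}"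
    then have le: "i \<le> d" "j \<le> d - i" "i' \<le> e" "j' \<le> e - i'" by auto
    have degree: "(i + i') + (j + j') + ((d - i - j) + (e - i' - j')) = d + e" using le by simp
    have mon: "(\<lambda>p. ?m d c i j p * ?m e c' i' j' p)
        = (\<lambda>(x, y, z). to_ac (c i j * c' i' j') * x ^ (i + i') * y ^ (j + j') * z ^ ((d - i - j) + (e - i' - j')))"
    proof
      fix p :: "'a alg_closure \<times> 'a alg_closure \<times> 'a alg_closure"
      show "?m d c i j p * ?m e c' i' j' p = (case p of (x, y, z) \<Rightarrow>
         to_ac (c i j * c' i' j') * x ^ (i + i') * y ^ (j + j') * z ^ ((d - i - j) + (e - i' - j')))"
        by (cases p) (simp only: power_add to_ac_mult mult_ac prod.case)
    qed
    show "is_form (d + e) (\<lambda>p. ?m d c i j p * ?m e c' i' j' p)"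
      using is_form_monomial[of "i + i'" "j + j'" "(d - i - j) + (e - i' - j')" "c i j * c' i' j'"]
      by (simp only: degree mon)
  qed
qed

lemma is_form_const: "is_form 0 (\<lambda>p. to_ac a)"
  using is_form_monomial[of 0 0 0 a] by (simp add: case_prod_unfold)

lemma is_form_power: "is_form d u \<Longrightarrow> is_form (d * n) (\<lambda>p. u p ^ n)"
proof (induction n)
  case 0
  then show ?case using is_form_const[of 1] by simp
next
  case (Suc n)
  then show ?case using is_form_mult[of d u "d * n" "\<lambda>p. u p ^ n"] by simp
qed

lemma is_form_compose:
  assumes "is_form e u" "is_form d f" "is_form d g" "is_form d h"
  shows "is_form (d * e) (\<lambda>p. u (f p, g p, h p))"
proof -
  obtain c where u: "u = form e c" using assms(1) by (auto simp: is_form_def)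
  have "is_form (d * e) (\<lambda>p. to_ac (c i j) * f p ^ i * g p ^ j * h p ^ (e - i - j))"
    if "i \<le> e" "j \<le> e - i" for i j
  proof -
    have "d * e = d * (i + j + (e - i - j))" using that by simp
    then have "d * e = 0 + d * i + d * j + d * (e - i - j)"
      by (simp only: distrib_left add_0)
    then show ?thesis
      using is_form_mult[OF is_form_mult[OF is_form_mult[OF is_form_const[of "c i j"]
        is_form_power[OF assms(2), of i]] is_form_power[OF assms(3), of j]] is_form_power[OF assms(4), of "e - i - j"]]
      by (simp only:)
  qed
  then show ?thesis unfolding u form.simps by (intro is_form_sum) auto
qed

lemma is_form_linear: "is_form 1 (\<lambda>(x, y, z). to_ac a * x + to_ac b * y + to_ac c * z)"
proof -
  have "is_form 1 (\<lambda>(x, y, z). to_ac a * x)" "is_form 1 (\<lambda>(x, y, z). to_ac b * y)"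
    "is_form 1 (\<lambda>(x, y, z). to_ac c * z)"
    using is_form_monomial[of 1 0 0 a] is_form_monomial[of 0 1 0 b] is_form_monomial[of 0 0 1 c] by simp_all
  from is_form_add[OF is_form_add[OF this(1,2)] this(3)] show ?thesis
    by (simp only: case_prod_unfold)
qed

section \<open>Composition and inversion of morphisms\<close>

lemma pointsE:
  assumes "P \<in> points E"
  obtains p where "P = proj_pt p" "p \<noteq> (0, 0, 0)" "wcubic E p = 0"
  using assms by (auto simp: points_def)

lemma point_eq_proj_pt: "P \<in> points E \<Longrightarrow> p \<in> P \<Longrightarrow> P = proj_pt p"
  by (metis pointsE proj_pt_eqI)

lemma infinity_in_points: "proj_pt (0, 1, 0) \<in> points E"
  by (simp add: points_eq)

lemma curve_morphism_iff:
  "curve_morphism E E' \<phi> \<longleftrightarrow>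
     \<phi> ` points (base_change E) \<subseteq> points (base_change E') \<and>
     (\<forall>P\<in>points (base_change E). \<exists>d f g h. is_form d f \<and> is_form d g \<and> is_form d h \<and>
        (\<exists>p\<in>P. (f p, g p, h p) \<noteq> (0, 0, 0)) \<and>
        (\<forall>Q\<in>points (base_change E). \<forall>p\<in>Q.
           (f p, g p, h p) \<noteq> (0, 0, 0) \<longrightarrow> \<phi> Q = proj_pt (f p, g p, h p)))"
proof -
  have *: "(\<exists>d f g h. A d (form d f) (form d g) (form d h)) \<longleftrightarrow>
      (\<exists>d f g h. is_form d f \<and> is_form d g \<and> is_form d h \<and> A d f g h)" for A
    unfolding is_form_def by blast
  show ?thesis unfolding curve_morphism_def *[symmetric] by (rule refl)
qed

lemma curve_morphism_points:
  "curve_morphism E E' \<phi> \<Longrightarrow> P \<in> points (base_change E) \<Longrightarrow> \<phi> P \<in> points (base_change E')"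
  by (auto simp: curve_morphism_def)

lemma curve_morphismE:
  assumes "curve_morphism E E' \<phi>" "P \<in> points (base_change E)"
  obtains d f g h p where "is_form d f" "is_form d g" "is_form d h"
    and "p \<in> P" "(f p, g p, h p) \<noteq> (0, 0, 0)"
    and "\<forall>Q\<in>points (base_change E). \<forall>p\<in>Q. (f p, g p, h p) \<noteq> (0, 0, 0) \<longrightarrow>
        \<phi> Q = proj_pt (f p, g p, h p)"
proof -
  from bspec[OF conjunct2[OF assms(1)[unfolded curve_morphism_iff]] assms(2)]
  obtain d f g h where *: "is_form d f" "is_form d g" "is_form d h"
    "\<exists>p\<in>P. (f p, g p, h p) \<noteq> (0, 0, 0)"
    "\<forall>Q\<in>points (base_change E). \<forall>p\<in>Q. (f p, g p, h p) \<noteq> (0, 0, 0) \<longrightarrow> \<phi> Q = proj_pt (f p, g p, h p)"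
    by (elim exE conjE) (rule that)
  from *(4) obtain p where "p \<in> P" "(f p, g p, h p) \<noteq> (0, 0, 0)" by (elim bexE)
  with *(5) show thesis by (intro that[OF *(1-3)])
qed

lemma curve_morphism_compose:
  assumes "curve_morphism E E' \<phi>" "curve_morphism E' E'' \<psi>"
  shows "curve_morphism E E'' (\<lambda>P. \<psi> (\<phi> P))"
  unfolding curve_morphism_iff
proof (intro conjI ballI)
  show "(\<lambda>P. \<psi> (\<phi> P)) ` points (base_change E) \<subseteq> points (base_change E'')"
    using assms by (auto simp: curve_morphism_iff)
  fix P assume P: "P \<in> points (base_change E)"
  note \<phi> = curve_morphism_points[OF assms(1)]
  obtain d f g h p where d: "is_form d f" "is_form d g" "is_form d h"
    and p: "p \<in> P" "(f p, g p, h p) \<noteq> (0, 0, 0)"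
    and fgh_all: "\<forall>Q\<in>points (base_change E). \<forall>p\<in>Q. (f p, g p, h p) \<noteq> (0, 0, 0) \<longrightarrow>
        \<phi> Q = proj_pt (f p, g p, h p)"
    by (rule curve_morphismE[OF assms(1) P]) (rule that; assumption)
  note fgh = fgh_all[rule_format]
  obtain e f' g' h' p' where e: "is_form e f'" "is_form e g'" "is_form e h'"
    and p': "p' \<in> \<phi> P" "(f' p', g' p', h' p') \<noteq> (0, 0, 0)"
    and fgh'_all: "\<forall>Q\<in>points (base_change E'). \<forall>p\<in>Q. (f' p, g' p, h' p) \<noteq> (0, 0, 0) \<longrightarrow>
        \<psi> Q = proj_pt (f' p, g' p, h' p)"
    by (rule curve_morphismE[OF assms(2) \<phi>[OF P]]) (rule that; assumption)
  note fgh' = fgh'_all[rule_format]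
  define F where "F = (\<lambda>p. (f p, g p, h p))"
  define comp where "comp = (\<lambda>u p. u (F p) :: 'a alg_closure)"
  have "\<phi> P = proj_pt (F p)" using fgh[OF P p] by (simp add: F_def)
  with p'(1) obtain t where "p' = (t * f p, t * g p, t * h p)"
    by (auto simp: F_def proj_pt_def)
  \<comment> \<open>Homogeneity carries the nonvanishing from the representative p' over to F
    p.\<close>
  with p'(2) have "(comp f' p, comp g' p, comp h' p) \<noteq> (0, 0, 0)"
    using is_form_homogeneous[OF e(1)] is_form_homogeneous[OF e(2)] is_form_homogeneous[OF e(3)]
    by (auto simp: comp_def F_def)
  moreover have "\<psi> (\<phi> Q) = proj_pt (comp f' q, comp g' q, comp h' q)"
    if Q: "Q \<in> points (base_change E)" and q: "q \<in> Q"
      and nz: "(comp f' q, comp g' q, comp h' q) \<noteq> (0, 0, 0)" for Q q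
  proof (cases "F q = (0, 0, 0)")
    case False
    then have "\<phi> Q = proj_pt (F q)" using fgh[OF Q q] by (simp add: F_def)
    then show ?thesis using fgh'[OF \<phi>[OF Q], of "F q"] in_proj_pt[of "F q"] nz
      by (simp add: comp_def)
  next
    case True
    \<comment> \<open>The local forms of \<phi> all vanish at q, but the composite does not. At the
      zero vector a form of degree e takes \<open>0 ^ e\<close> times any of its values, so e = 0:
      the forms of \<psi> are constants, and any representative of \<phi> Q will do.\<close>
    then have 0: "comp u q = 0 ^ e * u (x, y, z)" if "is_form e u" for u x y z
      using is_form_homogeneous[OF that, of 0 x y z] by (simp add: comp_def)
    then have "e = 0" using nz e by (metis power_0_left mult_zero_left)
    with 0 have const: "comp u q = u r" if "is_form e u" for u r
      using that by (cases r) simp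
    obtain r where r: "r \<in> \<phi> Q" using \<phi>[OF Q] by (metis pointsE in_proj_pt)
    show ?thesis
      using fgh'[OF \<phi>[OF Q] r] nz unfolding const[OF e(1), of r] const[OF e(2), of r] const[OF e(3), of r] .
  qed
  ultimately show "\<exists>d f g h. is_form d f \<and> is_form d g \<and> is_form d h \<and>
        (\<exists>p\<in>P. (f p, g p, h p) \<noteq> (0, 0, 0)) \<and>
        (\<forall>Q\<in>points (base_change E). \<forall>p\<in>Q.
           (f p, g p, h p) \<noteq> (0, 0, 0) \<longrightarrow> \<psi> (\<phi> Q) = proj_pt (f p, g p, h p))"
    using is_form_compose[OF e(1) d] is_form_compose[OF e(2) d] is_form_compose[OF e(3) d] p(1)
    by (intro exI[of _ "d * e"] exI[of _ "comp f'"] exI[of _ "comp g'"] exI[of _ "comp h'"])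
      (auto simp: comp_def F_def)
qed

lemma isomorphic_sym:
  assumes "isomorphic E E'"
  shows "isomorphic E' E"
proof -
  obtain \<phi> \<psi> where *: "curve_morphism E E' \<phi>" "curve_morphism E' E \<psi>"
    "\<forall>P\<in>points (base_change E). \<psi> (\<phi> P) = P" "\<forall>P\<in>points (base_change E'). \<phi> (\<psi> P) = P"
    "\<phi> (proj_pt (0, 1, 0)) = proj_pt (0, 1, 0)"
    using assms by (auto simp: isomorphic_def)
  moreover from this have "\<psi> (proj_pt (0, 1, 0)) = proj_pt (0, 1, 0)"
    using infinity_in_points by metis
  ultimately show ?thesis unfolding isomorphic_def by blast
qed

lemma isomorphic_trans:
  assumes "isomorphic E E'" "isomorphic E' E''"
  shows "isomorphic E E''"
proof -
  obtain \<phi> \<psi> where 1: "curve_morphism E E' \<phi>" "curve_morphism E' E \<psi>"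
    "\<forall>P\<in>points (base_change E). \<psi> (\<phi> P) = P" "\<forall>P\<in>points (base_change E'). \<phi> (\<psi> P) = P"
    "\<phi> (proj_pt (0, 1, 0)) = proj_pt (0, 1, 0)"
    using assms(1) by (auto simp: isomorphic_def)
  obtain \<phi>' \<psi>' where 2: "curve_morphism E' E'' \<phi>'" "curve_morphism E'' E' \<psi>'"
    "\<forall>P\<in>points (base_change E'). \<psi>' (\<phi>' P) = P" "\<forall>P\<in>points (base_change E''). \<phi>' (\<psi>' P) = P"
    "\<phi>' (proj_pt (0, 1, 0)) = proj_pt (0, 1, 0)"
    using assms(2) by (auto simp: isomorphic_def)
  have "\<phi> P \<in> points (base_change E')" if "P \<in> points (base_change E)" for P
    using 1(1) that by (auto simp: curve_morphism_def)
  moreover have "\<psi>' P \<in> points (base_change E')" if "P \<in> points (base_change E'')" for P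
    using 2(2) that by (auto simp: curve_morphism_def)
  ultimately show ?thesis unfolding isomorphic_def
    using curve_morphism_compose[OF 1(1) 2(1)] curve_morphism_compose[OF 2(2) 1(2)] 1(3-5) 2(3-5)
    by (intro exI[of _ "\<lambda>P. \<phi>' (\<phi> P)"] exI[of _ "\<lambda>P. \<psi> (\<psi>' P)"]) simp
qed

text \<open>Since a point is the set of its coordinate vectors, an invertible linear map can act on
  points as direct image.\<close>

lemma image_linear_proj_pt:
  assumes "is_form 1 f" "is_form 1 g" "is_form 1 h"
  shows "(\<lambda>p. (f p, g p, h p)) ` proj_pt p = proj_pt (f p, g p, h p)"
proof -
  obtain x y z where p: "p = (x, y, z)" by (cases p)
  have "u (c * x, c * y, c * z) = c * u p" if "is_form 1 u" for c u
    using is_form_homogeneous[OF that] by (simp add: p)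
  note hom = this[OF assms(1)] this[OF assms(2)] this[OF assms(3)]
  have "proj_pt (x, y, z) = (\<lambda>c. (c * x, c * y, c * z)) ` {c. c \<noteq> 0}" for x y z :: "'a alg_closure"
    by (auto simp: proj_pt_def)
  then show ?thesis by (simp add: p image_image hom[unfolded p])
qed

lemma curve_morphism_linear:
  assumes form: "is_form 1 f" "is_form 1 g" "is_form 1 h"
    and maps: "\<And>p. wcubic (base_change E) p = 0 \<Longrightarrow> wcubic (base_change E') (f p, g p, h p) = 0"
    and nz: "\<And>p. p \<noteq> (0, 0, 0) \<Longrightarrow> (f p, g p, h p) \<noteq> (0, 0, 0)"
  shows "curve_morphism E E' ((`) (\<lambda>p. (f p, g p, h p)))"
  unfolding curve_morphism_iff
proof (intro conjI ballI)
  note im = image_linear_proj_pt[OF form]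
  show "(`) (\<lambda>p. (f p, g p, h p)) ` points (base_change E) \<subseteq> points (base_change E')"
  proof clarify
    fix P assume "P \<in> points (base_change E)"
    then obtain p where "P = proj_pt p" "p \<noteq> (0, 0, 0)" "wcubic (base_change E) p = 0" by (rule pointsE)
    then show "(\<lambda>p. (f p, g p, h p)) ` P \<in> points (base_change E')"
      using im maps nz unfolding points_def by blast
  qed
  fix P assume P: "P \<in> points (base_change E)"
  then obtain p where "P = proj_pt p" "p \<noteq> (0, 0, 0)" by (rule pointsE)
  then have "p \<in> P" "(f p, g p, h p) \<noteq> (0, 0, 0)" using in_proj_pt nz by blast+
  moreover have "(\<lambda>p. (f p, g p, h p)) ` Q = proj_pt (f q, g q, h q)"
    if "Q \<in> points (base_change E)" "q \<in> Q" for Q q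
    using point_eq_proj_pt[OF that] im by simp
  ultimately show "\<exists>d f' g' h'. is_form d f' \<and> is_form d g' \<and> is_form d h' \<and>
        (\<exists>p\<in>P. (f' p, g' p, h' p) \<noteq> (0, 0, 0)) \<and>
        (\<forall>Q\<in>points (base_change E). \<forall>p\<in>Q.
           (f' p, g' p, h' p) \<noteq> (0, 0, 0) \<longrightarrow> (\<lambda>p. (f p, g p, h p)) ` Q = proj_pt (f' p, g' p, h' p))"
    using form by blast
qed

section \<open>Changes of variables\<close>

text \<open>The admissible change of Weierstrass coordinates x = u^2 x' + r, y = u^3 y' + s u^2 x' +
  t, homogenized; it scales the equation by u^6.\<close>

fun change :: "'a::field \<Rightarrow> 'a \<Rightarrow> 'a \<Rightarrow> 'a \<Rightarrow> 'a \<times> 'a \<times> 'a \<Rightarrow> 'a \<times> 'a \<times> 'a" where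
  "change u r s t (x, y, z) = (u^2 * x + r * z, u^3 * y + s * u^2 * x + t * z, z)"

lemma image_linear_change:
  fixes u r s t :: "'a::field"
  obtains f g h where "is_form 1 f" "is_form 1 g" "is_form 1 h"
    "change (to_ac u) (to_ac r) (to_ac s) (to_ac t) = (\<lambda>p. (f p, g p, h p))"
proof
  show "change (to_ac u) (to_ac r) (to_ac s) (to_ac t) =
    (\<lambda>p. ((\<lambda>(x, y, z). to_ac (u^2) * x + to_ac 0 * y + to_ac r * z) p,
          (\<lambda>(x, y, z). to_ac (s * u^2) * x + to_ac (u^3) * y + to_ac t * z) p,
          (\<lambda>(x, y, z). to_ac 0 * x + to_ac 0 * y + to_ac 1 * z) p))"
    by (rule ext) (auto simp: algebra_simps)
qed (rule is_form_linear)+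

lemma change_inverse:
  assumes "u \<noteq> 0"
  shows "change (1 / u) (- r / u^2) (- s / u) ((r * s - t) / u^3) (change u r s t p) = p"
    and "change u r s t (change (1 / u) (- r / u^2) (- s / u) ((r * s - t) / u^3) p) = p"
  using assms by (cases p; simp add: field_simps power2_eq_square power3_eq_cube)+

lemma change_0 [simp]: "change u r s t (0, 0, 0) = (0, 0, 0)"
  by simp

text \<open>One identity of cubics over the closure serves both directions: it is read at p for the
  map and at \<open>M p\<close> for its inverse.\<close>

lemma isomorphic_change:
  fixes E E' :: "'a::field weierstrass"
  assumes u: "u \<noteq> 0"
    and change: "\<And>p. wcubic (base_change E) (change (to_ac u) (to_ac r) (to_ac s) (to_ac t) p)
      = to_ac u ^ 6 * wcubic (base_change E') p"
  shows "isomorphic E' E"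
proof -
  define L where "L = change (to_ac u) (to_ac r) (to_ac s) (to_ac t)"
  define M where "M = change (to_ac (1 / u)) (to_ac (- r / u^2)) (to_ac (- s / u)) (to_ac ((r * s - t) / u^3))"
  have M_L: "M (L p) = p" and L_M: "L (M p) = p" for p
    using change_inverse[of "to_ac u" "to_ac r" "to_ac s" "to_ac t" p] u by (simp_all add: L_def M_def)
  have L0: "L (0, 0, 0) = (0, 0, 0)" and M0: "M (0, 0, 0) = (0, 0, 0)" by (simp_all add: L_def M_def)
  obtain f g h where fgh: "is_form 1 f" "is_form 1 g" "is_form 1 h" "L = (\<lambda>p. (f p, g p, h p))"
    unfolding L_def by (rule image_linear_change)
  obtain f' g' h' where fgh': "is_form 1 f'" "is_form 1 g'" "is_form 1 h'" "M = (\<lambda>p. (f' p, g' p, h' p))"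
    unfolding M_def by (rule image_linear_change)
  have E: "wcubic (base_change E) (L p) = to_ac u ^ 6 * wcubic (base_change E') p" for p
    using change by (simp add: L_def)
  have "curve_morphism E' E ((`) L)"
    unfolding fgh(4)
  proof (rule curve_morphism_linear[OF fgh(1-3)])
    show "wcubic (base_change E) (f p, g p, h p) = 0" if "wcubic (base_change E') p = 0" for p
      using E[of p] that unfolding fgh(4) by simp
    show "(f p, g p, h p) \<noteq> (0, 0, 0)" if "p \<noteq> (0, 0, 0)" for p
      using M_L[of p] M0 that unfolding fgh(4) by metis
  qed
  moreover have "curve_morphism E E' ((`) M)"
    unfolding fgh'(4)
  proof (rule curve_morphism_linear[OF fgh'(1-3)])
    show "wcubic (base_change E') (f' p, g' p, h' p) = 0" if "wcubic (base_change E) p = 0" for p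
      using E[of "M p"] that u unfolding L_M unfolding fgh'(4) by simp
    show "(f' p, g' p, h' p) \<noteq> (0, 0, 0)" if "p \<noteq> (0, 0, 0)" for p
      using L_M[of p] L0 that unfolding fgh'(4) by metis
  qed
  moreover have "L ` proj_pt (0, 1, 0) = proj_pt (0, 1, 0)"
  proof -
    have "L (0, 1, 0) = (to_ac u ^ 3 * 0, to_ac u ^ 3 * 1, to_ac u ^ 3 * 0)" by (simp add: L_def)
    then have "proj_pt (L (0, 1, 0)) = proj_pt (0, 1, 0)"
      using u proj_pt_scale[of "to_ac u ^ 3" 0 1 0] by simp
    then show ?thesis using image_linear_proj_pt[OF fgh(1-3)] unfolding fgh(4) by simp
  qed
  ultimately show ?thesis
    unfolding isomorphic_def
    by (intro exI[of _ "(`) L"] exI[of _ "(`) M"]) (simp add: image_image L_M M_L)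
qed

lemma isomorphic_refl: "isomorphic E E"
proof (rule isomorphic_change)
  show "wcubic (base_change E) (change (to_ac 1) (to_ac 0) (to_ac 0) (to_ac 0) p) = to_ac 1 ^ 6 * wcubic (base_change E) p" for p
    by (cases p) simp
qed simp

section \<open>Normal form at a flex\<close>

text \<open>The assumptions are the transformation formulas for the coefficients: the new a1 is a,
  the new a3 is 1, and the new a2, a4, a6 vanish.\<close>

lemma wcubic_change:
  fixes a :: "'a::field"
  assumes "a1 + 2 * s = u * a" "a3 + r * a1 + 2 * t = u^3" "3 * r = s^2 + a1 * s - a2"
    "a4 + 2 * r * a2 + 3 * r^2 = s * a3 + (t + r * s) * a1 + 2 * s * t"
    "t^2 + a1 * r * t + a3 * t = r^3 + a2 * r^2 + a4 * r + a6"
  shows "wcubic (Weierstrass a1 a2 a3 a4 a6) (change u r s t p) = u^6 * wcubic (Weierstrass a 0 1 0 0) p"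
proof -
  obtain x y z where p: "p = (x, y, z)" by (cases p)
  have "(u^3 * y + s * u^2 * x + t * z)^2 * z + a1 * (u^2 * x + r * z) * (u^3 * y + s * u^2 * x + t * z) * z
      + a3 * (u^3 * y + s * u^2 * x + t * z) * z^2 - ((u^2 * x + r * z)^3 + a2 * (u^2 * x + r * z)^2 * z
      + a4 * (u^2 * x + r * z) * z^2 + a6 * z^3)
    = u^6 * y^2 * z + (a1 + 2 * s) * u^5 * x * y * z + (a3 + r * a1 + 2 * t) * u^3 * y * z^2 - u^6 * x^3
     + (s^2 + a1 * s - a2 - 3 * r) * u^4 * x^2 * z
     + ((s * a3 + (t + r * s) * a1 + 2 * s * t) - (a4 + 2 * r * a2 + 3 * r^2)) * u^2 * x * z^2
     + ((t^2 + a1 * r * t + a3 * t) - (r^3 + a2 * r^2 + a4 * r + a6)) * z^3"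
    by (simp add: algebra_simps eval_nat_numeral)
  also have "\<dots> = u^6 * (y^2 * z + a * x * y * z + y * z^2 - x^3)"
    unfolding assms by (simp add: algebra_simps eval_nat_numeral)
  finally show ?thesis by (simp add: p)
qed

text \<open>At a flex, r is a triple root of the restriction to y = s x + k. Comparing coefficients
  says that the new a2, a4, a6 vanish after \<open>change\<close> with these r, s, t; the last
  equation is the tangent direction.\<close>

lemma flex_normal_form:
  fixes a1 a2 a3 a4 a6 :: "'a::field"
  assumes "collinear (Weierstrass a1 a2 a3 a4 a6) (Some (r, t)) (Some (r, t)) (Some (r, t))"
  obtains s where "3 * r = s^2 + a1 * s - a2"
    "a4 + 2 * r * a2 + 3 * r^2 = s * a3 + (t + r * s) * a1 + 2 * s * t"
    "t^2 + a1 * r * t + a3 * t = r^3 + a2 * r^2 + a4 * r + a6"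
    "s * (a3 + r * a1 + 2 * t) = 3 * r^2 + 2 * a2 * r + a4 - a1 * t"
proof -
  obtain s k where t: "t = s * r + k" and sum: "r + r + r = s^2 + a1 * s - a2"
    and sum2: "r * r + r * r + r * r = a4 - 2 * s * k - a1 * k - a3 * s"
    and prod: "r * r * r = k^2 + a3 * k - a6"
    using assms by auto
  show thesis
  proof (rule that[of s])
    show "3 * r = s^2 + a1 * s - a2" using sum by simp
    show "a4 + 2 * r * a2 + 3 * r^2 = s * a3 + (t + r * s) * a1 + 2 * s * t"
      using t sum sum2 by Groebner_Basis.algebra
    show "t^2 + a1 * r * t + a3 * t = r^3 + a2 * r^2 + a4 * r + a6"
      using t sum sum2 prod by Groebner_Basis.algebra
    have "s * (2 * t + a1 * r + a3) = 3 * r^2 + 2 * a2 * r + a4 - a1 * t"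
      using t sum sum2 by (rule tangent_slope)
    then show "s * (a3 + r * a1 + 2 * t) = 3 * r^2 + 2 * a2 * r + a4 - a1 * t"
      by (simp add: algebra_simps)
  qed
qed

text \<open>The curve \<open>y^2 + 3 x y + y = x^3\<close> is singular at \<open>(1 : -1 : -1)\<close>.\<close>

lemma singular_if_normal_form_3:
  fixes u :: "'a::field"
  assumes "u \<noteq> 0" "a1 + 2 * s = u * 3" "a3 + r * a1 + 2 * t = u^3" "3 * r = s^2 + a1 * s - a2"
    "a4 + 2 * r * a2 + 3 * r^2 = s * a3 + (t + r * s) * a1 + 2 * s * t"
    "t^2 + a1 * r * t + a3 * t = r^3 + a2 * r^2 + a4 * r + a6"
  shows "wcubic_grad (Weierstrass a1 a2 a3 a4 a6) (change u r s t (1, -1, -1)) = (0, 0, 0)"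
proof -
  define x y where "x = u^2 - r" and "y = - (u^3) + s * u^2 - t"
  have p: "change u r s t (1, -1, -1) = (x, y, -1)" by (simp add: x_def y_def)
  define Fx Fy Fz where "Fx = - (a1 * y) - (3 * x^2 - 2 * a2 * x + a4)"
    and "Fy = - (2 * y) - a1 * x + a3"
    and "Fz = y^2 + a1 * x * y - 2 * a3 * y - (a2 * x^2 - 2 * a4 * x + 3 * a6)"
  \<comment> \<open>Solving for the coefficients turns the three claims into polynomial identities
    in u, r, s, t.\<close>
  have a1: "a1 = 3 * u - 2 * s" using assms(2) by (simp add: algebra_simps)
  have a3: "a3 = u^3 - r * (3 * u - 2 * s) - 2 * t" using assms(3) by (simp add: a1 algebra_simps)
  have a2: "a2 = s^2 + (3 * u - 2 * s) * s - 3 * r" using assms(4) by (simp add: a1 algebra_simps)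
  have "a4 = s * a3 + (t + r * s) * a1 + 2 * s * t - 2 * r * a2 - 3 * r^2"
    using assms(5) by (simp add: algebra_simps)
  note a4 = this[unfolded a1 a2 a3]
  have "a6 = t^2 + a1 * r * t + a3 * t - r^3 - a2 * r^2 - a4 * r"
    using assms(6) by (simp add: algebra_simps)
  note a6 = this[unfolded a1 a2 a3 a4]
  have "Fy = 0"
    unfolding Fy_def x_def y_def a1 a3 by (simp add: algebra_simps eval_nat_numeral)
  moreover have "Fx = 0"
    unfolding Fx_def x_def y_def a1 a2 a4 by (simp add: algebra_simps eval_nat_numeral)
  moreover have "Fz = 0"
    unfolding Fz_def x_def y_def a1 a2 a3 a4 a6 by (simp add: algebra_simps eval_nat_numeral)
  ultimately show ?thesis unfolding p by (simp add: Fx_def Fy_def Fz_def algebra_simps)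
qed

lemma wcubic_base_change:
  "wcubic (base_change E) (to_ac x, to_ac y, to_ac z) = to_ac (wcubic E (x, y, z))"
  by (cases E) simp

lemma wcubic_grad_base_change:
  "wcubic_grad (base_change E) (to_ac x, to_ac y, to_ac z) = (0, 0, 0) \<longleftrightarrow> wcubic_grad E (x, y, z) = (0, 0, 0)"
proof -
  have "wcubic_grad (base_change E) (to_ac x, to_ac y, to_ac z) =
    (case wcubic_grad E (x, y, z) of (a, b, c) \<Rightarrow> (to_ac a, to_ac b, to_ac c))"
    by (cases E) simp
  then show ?thesis by (auto split: prod.splits)
qed

lemma elliptic_curveD:
  assumes "elliptic_curve E" "p \<noteq> (0, 0, 0)" "wcubic E p = 0"
  shows "wcubic_grad E p \<noteq> (0, 0, 0)"
proof -
  obtain x y z where p: "p = (x, y, z)" by (cases p)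
  have "(to_ac x, to_ac y, to_ac z) \<noteq> (0, 0, 0)" using assms(2) by (simp add: p)
  moreover have "wcubic (base_change E) (to_ac x, to_ac y, to_ac z) = 0"
    using assms(3) by (simp only: p wcubic_base_change to_ac_0)
  ultimately show ?thesis
    using assms(1) wcubic_grad_base_change unfolding elliptic_curve_def p by blast
qed

lemma elliptic_curve_imp_affine_smooth: "elliptic_curve E \<Longrightarrow> affine_smooth E"
  unfolding affine_smooth_def affine_points_def using elliptic_curveD by fastforce

lemma ex_isomorphic_normal_form:
  fixes E :: "'a::{field,finite} weierstrass"
  assumes card: "[CARD('a) = 2] (mod 3)" and E: "E \<in> curves_3"
  shows "\<exists>a. a \<noteq> 3 \<and> isomorphic (Weierstrass a 0 1 0 0) E"
proof -
  have ell: "elliptic_curve E" and "3 dvd card (points E)" using E by (auto simp: curves_3_def)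
  then have smooth: "affine_smooth E" by (intro elliptic_curve_imp_affine_smooth)
  obtain a1 a2 a3 a4 a6 where W: "E = Weierstrass a1 a2 a3 a4 a6" by (cases E)
  obtain r t where "collinear E (Some (r, t)) (Some (r, t)) (Some (r, t))"
    using ex_affine_flex[OF smooth \<open>3 dvd card (points E)\<close>] by blast
  from flex_normal_form[OF this[unfolded W]] obtain s where
    s: "3 * r = s^2 + a1 * s - a2"
    "a4 + 2 * r * a2 + 3 * r^2 = s * a3 + (t + r * s) * a1 + 2 * s * t"
    "t^2 + a1 * r * t + a3 * t = r^3 + a2 * r^2 + a4 * r + a6"
    and slope: "s * (a3 + r * a1 + 2 * t) = 3 * r^2 + 2 * a2 * r + a4 - a1 * t" by blast
  obtain u where u: "u^3 = a3 + r * a1 + 2 * t"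
    using surj_cube[OF card] by (metis surjD)
  \<comment> \<open>u^3 is F_y at the flex; if it vanished, the tangent equation would give F_x = 0
    as well.\<close>
  have "u \<noteq> 0"
  proof
    assume "u = 0"
    then have 0: "a3 + r * a1 + 2 * t = 0" using u by simp
    have "(r, t) \<in> affine_points E" using s(3) by (simp add: affine_points_def W)
    then have "a1 * t \<noteq> 3 * r^2 + 2 * a2 * r + a4"
      using 0 smooth unfolding W by (intro affine_smoothD) (auto simp: algebra_simps)
    then show False using slope 0 by simp
  qed
  define a where "a = (a1 + 2 * s) / u"
  have a: "a1 + 2 * s = u * a" using \<open>u \<noteq> 0\<close> by (simp add: a_def)
  have change: "wcubic E (change u r s t p) = u^6 * wcubic (Weierstrass a 0 1 0 0) p" for p
    unfolding W by (rule wcubic_change) (use a u s in auto)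
  have "isomorphic (Weierstrass a 0 1 0 0) E"
  proof (rule isomorphic_change[OF \<open>u \<noteq> 0\<close>])
    fix p
    \<comment> \<open>The isomorphism lives over the closure, so the conditions on the coefficients
      are carried there by \<open>to_ac\<close>.\<close>
    have "wcubic (Weierstrass (to_ac a1) (to_ac a2) (to_ac a3) (to_ac a4) (to_ac a6))
        (change (to_ac u) (to_ac r) (to_ac s) (to_ac t) p)
      = to_ac u ^ 6 * wcubic (Weierstrass (to_ac a) 0 1 0 0) p"
      using arg_cong[OF a, of to_ac] arg_cong[OF u, of to_ac] s[THEN arg_cong, of to_ac]
      by (intro wcubic_change) simp_all
    then show "wcubic (base_change E) (change (to_ac u) (to_ac r) (to_ac s) (to_ac t) p)
      = to_ac u ^ 6 * wcubic (base_change (Weierstrass a 0 1 0 0)) p"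
      by (simp add: W)
  qed
  moreover have "a \<noteq> 3"
  proof
    assume "a = 3"
    then have "wcubic_grad E (change u r s t (1, -1, -1)) = (0, 0, 0)"
      unfolding W using \<open>u \<noteq> 0\<close> a u s by (intro singular_if_normal_form_3) auto
    moreover have "wcubic E (change u r s t (1, -1, -1)) = 0"
      using \<open>a = 3\<close> unfolding change by simp
    moreover have "change u r s t (1, -1, -1) \<noteq> (0, 0, 0)" by simp
    ultimately show False using elliptic_curveD[OF ell] by blast
  qed
  ultimately show ?thesis by blast
qed

section \<open>The curves of the family\<close>

text \<open>A singular point satisfies y = z and a x = - 3 y, hence x^3 = - y^3 and a^3 = 27; in F_q
  this leaves only a = 3.\<close>

lemma elliptic_curve_normal_form:
  fixes a :: "'a::{field,finite}"
  assumes card: "[CARD('a) = 2] (mod 3)" and "a \<noteq> 3"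
  shows "elliptic_curve (Weierstrass a 0 1 0 0)"
  unfolding elliptic_curve_def
proof (intro allI impI notI, elim conjE)
  fix p :: "'a alg_closure \<times> 'a alg_closure \<times> 'a alg_closure"
  assume p: "p \<noteq> (0, 0, 0)" "wcubic (base_change (Weierstrass a 0 1 0 0)) p = 0"
    "wcubic_grad (base_change (Weierstrass a 0 1 0 0)) p = (0, 0, 0)"
  obtain x y z where xyz: "p = (x, y, z)" by (cases p)
  define b where "b = to_ac a"
  have C: "y^2 * z + b * x * y * z + y * z^2 = x^3"
    and Fx: "b * y * z = 3 * x^2" and Fy: "z * (2 * y + b * x + z) = 0" and Fz: "y * (y + b * x + 2 * z) = 0"
    using p by (simp_all add: xyz b_def algebra_simps power2_eq_square)
  have "y \<noteq> 0"
  proof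
    assume "y = 0"
    with C have "x = 0" by simp
    with Fy \<open>y = 0\<close> p(1) show False by (simp add: xyz)
  qed
  moreover have "z \<noteq> 0"
  proof
    assume "z = 0"
    with C have "x = 0" by simp
    with Fz \<open>z = 0\<close> p(1) show False by (simp add: xyz)
  qed
  ultimately have 1: "2 * y + b * x + z = 0" and 2: "y + b * x + 2 * z = 0" using Fy Fz by auto
  then have "y = z" by Groebner_Basis.algebra
  with 1 have bx: "b * x = - 3 * y" by Groebner_Basis.algebra
  have "x^3 = - (y^3)" using C \<open>y = z\<close> bx by Groebner_Basis.algebra
  then have "x \<noteq> 0" using \<open>y \<noteq> 0\<close> by auto
  have "b^3 * x^3 = 27 * x^3" using bx \<open>x^3 = - (y^3)\<close> by Groebner_Basis.algebra
  then have "b^3 = 27" using \<open>x \<noteq> 0\<close> by simp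
  then have "to_ac (a^3) = to_ac (3^3)" by (simp add: b_def)
  then have "a^3 = 3^3" by (simp only: to_ac_eq_iff)
  then show False using injD[OF inj_cube[OF card], of a 3] \<open>a \<noteq> 3\<close> by blast
qed

text \<open>Dividing the equation \<open>y z (y + a x + z) = x^3\<close> by \<open>x^3\<close> shows that translation by the point
  \<open>(0, 0)\<close> of order 3 is the cyclic rotation of the three factors.\<close>

lemma three_dvd_card_points_normal_form:
  fixes a :: "'a::{field,finite}"
  assumes card: "[CARD('a) = 2] (mod 3)" and "a \<noteq> 3"
  shows "3 dvd card (points (Weierstrass a 0 1 0 0))"
proof -
  let ?E = "Weierstrass a 0 1 0 0"
  define B where "B = {(y, z). y * z * (y + z + a) = 1}"
  \<comment> \<open>The numbers y, z, - (a + y + z) have sum - a and product - 1; \<rho> rotates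
    them.\<close>
  define \<rho> where "\<rho> = (\<lambda>(y, z). (z, - (a + y + z)))"
  have "[card B = card {b \<in> B. \<rho> b = b}] (mod 3)"
    by (rule card_cong_card_fixpoints_mod_3) (auto simp: B_def \<rho>_def algebra_simps)
  moreover have "{b \<in> B. \<rho> b = b} = {}"
  proof -
    \<comment> \<open>A fixed pair makes the three numbers equal, so a = - 3 y and (- y)^3 = 1, that
      is y = - 1 and a = 3.\<close>
    have False if "(y, z) \<in> B" "\<rho> (y, z) = (y, z)" for y z
    proof -
      have yz: "z = y" and z: "- (a + y + z) = z" using that(2) by (auto simp: \<rho>_def)
      from z have "a + y + z + z = 0" by (simp only: neg_eq_iff_add_eq_0)
      then have "a + 3 * y = 0" unfolding yz by (simp add: algebra_simps)
      then have "a = - (3 * y)" by (rule eq_neg_iff_add_eq_0[THEN iffD2])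
      then have a: "a = - 3 * y" by simp
      have "(- y)^3 = y * y * (y + y + - 3 * y)"
        by (simp add: algebra_simps power3_eq_cube)
      also have "\<dots> = 1^3" using that(1) unfolding B_def yz a by simp
      finally have "(- y)^3 = 1^3" .
      then have "- y = 1" using injD[OF inj_cube[OF card], of "- y" 1] by blast
      moreover have "a = 3 * (- y)" using a by simp
      ultimately show False using \<open>a \<noteq> 3\<close> by (simp only: mult_1_right)
    qed
    then show ?thesis by auto
  qed
  ultimately have "3 dvd card B" by (simp add: cong_def dvd_eq_mod_eq_0)
  define A where "A = {p \<in> affine_points ?E. fst p \<noteq> 0}"
  have scale: "(x, y) \<in> A \<longleftrightarrow> x \<noteq> 0 \<and> (y / x, 1 / x) \<in> B" for x y
  proof (cases "x = 0")
    case False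
    then have "wcubic ?E (x, y, 1) = x^3 * (y / x * (1 / x) * (y / x + 1 / x + a) - 1)"
      by (simp add: field_simps power2_eq_square power3_eq_cube)
    then have "wcubic ?E (x, y, 1) = 0 \<longleftrightarrow> y / x * (1 / x) * (y / x + 1 / x + a) = 1"
      using False by (simp only: mult_eq_0_iff power_eq_0_iff right_minus_eq simp_thms)
    then show ?thesis
      by (simp only: A_def B_def affine_points_def mem_Collect_eq prod.case fst_conv) blast
  qed (simp add: A_def)
  \<comment> \<open>The two maps come from (x : y : 1) = (1 : y / x : 1 / x).\<close>
  have "bij_betw (\<lambda>(y, z). (1 / z, y / z)) B A"
  proof (rule bij_betw_byWitness[of _ "\<lambda>(x, y). (y / x, 1 / x)"])
    show "\<forall>b\<in>B. (case case b of (y, z) \<Rightarrow> (1 / z, y / z) of (x, y) \<Rightarrow> (y / x, 1 / x)) = b"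
      by (auto simp: B_def)
    show "\<forall>p\<in>A. (case case p of (x, y) \<Rightarrow> (y / x, 1 / x) of (y, z) \<Rightarrow> (1 / z, y / z)) = p"
      by (auto simp: A_def)
    show "(\<lambda>(y, z). (1 / z, y / z)) ` B \<subseteq> A"
    proof clarify
      fix y z assume yz: "(y, z) \<in> B"
      then have "z \<noteq> 0" by (auto simp: B_def)
      with yz show "(1 / z, y / z) \<in> A" by (simp add: scale)
    qed
    show "(\<lambda>(x, y). (y / x, 1 / x)) ` A \<subseteq> B"
      using scale by auto
  qed
  then have "card B = card A" by (rule bij_betw_same_card)
  have roots: "y^2 + y = 0 \<longleftrightarrow> y = 0 \<or> y = - 1" for y :: 'a
  proof -
    have "y^2 + y = y * (y + 1)" by (simp add: algebra_simps power2_eq_square)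
    then show ?thesis by (simp only: mult_eq_0_iff eq_neg_iff_add_eq_0)
  qed
  \<comment> \<open>Besides \<open>A\<close> there remain (0, 0), (0, -1) and the point at infinity:
    again three.\<close>
  have "affine_points ?E = A \<union> {(0, 0), (0, - 1)}"
    by (auto simp: A_def affine_points_def roots)
  moreover have "A \<inter> {(0, 0), (0, - 1)} = {}" by (auto simp: A_def)
  ultimately have "card (affine_points ?E) = card A + 2"
    by (simp add: card_Un_disjoint)
  then have "card (points ?E) = card A + 3" by (simp add: card_points)
  with \<open>3 dvd card B\<close> \<open>card B = card A\<close> show ?thesis by simp
qed

section \<open>Rigidity of the family\<close>

lemma is_form_rational:
  assumes "is_form d u"
  shows "u (to_ac x, to_ac y, to_ac z) \<in> range to_ac"
proof -
  obtain c where u: "u = form d c" using assms by (auto simp: is_form_def)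
  have "u (to_ac x, to_ac y, to_ac z) = to_ac (\<Sum>i\<le>d. \<Sum>j\<le>d - i. c i j * x ^ i * y ^ j * z ^ (d - i - j))"
    by (simp add: u to_ac_sum)
  then show ?thesis by blast
qed


abbreviation family_V :: "'a::field \<Rightarrow> ('a alg_closure \<times> 'a alg_closure) set" where
  "family_V a \<equiv> cubic_curve.V [:1, to_ac a:] (monom 1 3)"

abbreviation family_regular :: "'a::field \<Rightarrow> ('a alg_closure \<times> 'a alg_closure \<Rightarrow> 'a alg_closure) \<Rightarrow> bool" where
  "family_regular a \<equiv> cubic_curve.regular [:1, to_ac a:] (monom 1 3)"

lemma cubic_curve_family: "cubic_curve [:1, to_ac a:] (monom 1 3)"
  by standard (simp_all add: degree_monom_eq)

lemma family_V_iff: "(x, y) \<in> family_V a \<longleftrightarrow> y^2 + (1 + to_ac a * x) * y = x^3"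
  by (simp add: cubic_curve.V_def[OF cubic_curve_family] poly_monom mult.commute)

lemma affine_points_family: "affine_points (base_change (Weierstrass a 0 1 0 0)) = family_V a"
  by (auto simp: affine_points_def family_V_iff algebra_simps)

lemma family_regular_form:
  assumes "is_form d w"
  shows "family_regular a (\<lambda>(x, y). w (x, y, 1))"
proof -
  interpret cubic_curve "[:1, to_ac a:]" "monom 1 3" by (rule cubic_curve_family)
  obtain c where w: "w = form d c" using assms by (auto simp: is_form_def)
  have "regular (\<lambda>p. \<Sum>i\<le>d. \<Sum>j\<le>d - i. to_ac (c i j) * fst p ^ i * snd p ^ j)"
    by (intro regular_sum regular_mult regular_const regular_power regular_fst regular_snd)
  then show ?thesis by (simp add: w case_prod_unfold)
qed

text \<open>Affine points stay affine because only infinity goes to infinity; dividing the first two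
  local forms by the third gives the coordinates as fractions. The values at (0, 0) are rational
  because the forms have coefficients in the ground field.\<close>

lemma morphism_coordinates:
  assumes \<phi>: "curve_morphism (Weierstrass a 0 1 0 0) (Weierstrass b 0 1 0 0) \<phi>"
    and infinity: "\<And>P. P \<in> points (base_change (Weierstrass a 0 1 0 0)) \<Longrightarrow>
      \<phi> P = proj_pt (0, 1, 0) \<Longrightarrow> P = proj_pt (0, 1, 0)"
  obtains u v where "family_regular a u" "family_regular a v"
    "\<forall>p\<in>family_V a. (u p, v p) \<in> family_V b"
    "\<forall>p\<in>family_V a. \<phi> (proj_pt (fst p, snd p, 1)) = proj_pt (u p, v p, 1)"
    "u (0, 0) \<in> range to_ac" "v (0, 0) \<in> range to_ac"
proof -
  let ?E = "base_change (Weierstrass a 0 1 0 0)" and ?E' = "base_change (Weierstrass b 0 1 0 0)"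
  interpret cubic_curve "[:1, to_ac a:]" "monom 1 3" by (rule cubic_curve_family)
  have in_points: "proj_pt (x, y, 1) \<in> points ?E" if "(x, y) \<in> V" for x y
    unfolding points_eq affine_points_family using that by blast
  have "\<forall>p\<in>V. \<exists>q. q \<in> family_V b \<and> \<phi> (proj_pt (fst p, snd p, 1)) = proj_pt (fst q, snd q, 1)"
  proof
    fix p assume p: "p \<in> V"
    let ?P = "proj_pt (fst p, snd p, 1)"
    have P: "?P \<in> points ?E" using in_points p by simp
    then have "\<phi> ?P \<in> points ?E'" by (rule curve_morphism_points[OF \<phi>])
    moreover have "\<phi> ?P \<noteq> proj_pt (0, 1, 0)" using infinity[OF P] by auto
    ultimately show "\<exists>q. q \<in> family_V b \<and> \<phi> ?P = proj_pt (fst q, snd q, 1)"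
      unfolding points_eq affine_points_family by auto
  qed
  from bchoice[OF this] obtain w
    where w_all: "\<forall>p\<in>V. w p \<in> family_V b \<and> \<phi> (proj_pt (fst p, snd p, 1)) = proj_pt (fst (w p), snd (w p), 1)"
    by (elim exE)
  have w: "w p \<in> family_V b" "\<phi> (proj_pt (fst p, snd p, 1)) = proj_pt (fst (w p), snd (w p), 1)" if "p \<in> V" for p
    using w_all that by blast+
  define u where "u = (\<lambda>p. fst (w p))"
  define v where "v = (\<lambda>p. snd (w p))"
  have fractions: "\<exists>d f g h. is_form d f \<and> is_form d g \<and> is_form d h \<and> h (x, y, 1) \<noteq> 0 \<and>
      (\<forall>(x', y') \<in> V. h (x', y', 1) * u (x', y') = f (x', y', 1) \<and> h (x', y', 1) * v (x', y') = g (x', y', 1))"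
    if xy: "(x, y) \<in> V" for x y
  proof -
    obtain d f g h p where form: "is_form d f" "is_form d g" "is_form d h"
      and p: "p \<in> proj_pt (x, y, 1)" "(f p, g p, h p) \<noteq> (0, 0, 0)"
      and all: "\<forall>Q\<in>points ?E. \<forall>p\<in>Q. (f p, g p, h p) \<noteq> (0, 0, 0) \<longrightarrow> \<phi> Q = proj_pt (f p, g p, h p)"
      by (rule curve_morphismE[OF \<phi> in_points[OF xy]]) (rule that; assumption)
    obtain c where c: "p = (c * x, c * y, c * 1)" using p(1) by (auto simp: proj_pt_def)
    have nz: "(f (x, y, 1), g (x, y, 1), h (x, y, 1)) \<noteq> (0, 0, 0)"
      using p(2) unfolding c form[THEN is_form_homogeneous] by auto
    have scale: "\<exists>c. c \<noteq> 0 \<and> f (x', y', 1) = c * u (x', y') \<and> g (x', y', 1) = c * v (x', y') \<and> h (x', y', 1) = c"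
      if "(x', y') \<in> V" and nz': "(f (x', y', 1), g (x', y', 1), h (x', y', 1)) \<noteq> (0, 0, 0)" for x' y'
    proof -
      let ?F = "(f (x', y', 1), g (x', y', 1), h (x', y', 1))"
      have "\<phi> (proj_pt (x', y', 1)) = proj_pt ?F"
        using all[rule_format, OF in_points[OF that(1)] in_proj_pt nz'] .
      then have "?F \<in> proj_pt (u (x', y'), v (x', y'), 1)"
        using w(2)[OF that(1)] in_proj_pt[of ?F] by (simp add: u_def v_def del: proj_pt_affine_eq_iff)
      then show ?thesis by (simp add: proj_pt_mem_iff)
    qed
    \<comment> \<open>Where all three forms vanish, both equations read 0 = 0, so they hold on the
      whole curve.\<close>
    have "h (x', y', 1) * u (x', y') = f (x', y', 1) \<and> h (x', y', 1) * v (x', y') = g (x', y', 1)"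
      if "(x', y') \<in> V" for x' y'
      using scale[OF that] by (cases "(f (x', y', 1), g (x', y', 1), h (x', y', 1)) = (0, 0, 0)") auto
    moreover have "h (x, y, 1) \<noteq> 0" using scale[OF xy nz] by blast
    ultimately show ?thesis using form by blast
  qed
  have "regular u"
  proof (rule regular_if_locally_fraction)
    fix P assume P: "P \<in> V"
    then obtain d f g h where *: "is_form d f" "is_form d g" "is_form d h" "h (fst P, snd P, 1) \<noteq> 0"
      "\<forall>(x', y') \<in> V. h (x', y', 1) * u (x', y') = f (x', y', 1) \<and> h (x', y', 1) * v (x', y') = g (x', y', 1)"
      using fractions[of "fst P" "snd P"] by auto
    show "\<exists>d v. regular d \<and> regular v \<and> d P \<noteq> 0 \<and> (\<forall>Q\<in>V. d Q * u Q = v Q)"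
      by (rule exI[of _ "\<lambda>(x, y). h (x, y, 1)"], rule exI[of _ "\<lambda>(x, y). f (x, y, 1)"])
        (use * family_regular_form in \<open>auto simp: case_prod_unfold\<close>)
  qed
  moreover have "regular v"
  proof (rule regular_if_locally_fraction)
    fix P assume P: "P \<in> V"
    then obtain d f g h where *: "is_form d f" "is_form d g" "is_form d h" "h (fst P, snd P, 1) \<noteq> 0"
      "\<forall>(x', y') \<in> V. h (x', y', 1) * u (x', y') = f (x', y', 1) \<and> h (x', y', 1) * v (x', y') = g (x', y', 1)"
      using fractions[of "fst P" "snd P"] by auto
    show "\<exists>d w. regular d \<and> regular w \<and> d P \<noteq> 0 \<and> (\<forall>Q\<in>V. d Q * v Q = w Q)"
      by (rule exI[of _ "\<lambda>(x, y). h (x, y, 1)"], rule exI[of _ "\<lambda>(x, y). g (x, y, 1)"])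
        (use * family_regular_form in \<open>auto simp: case_prod_unfold\<close>)
  qed
  moreover have "u (0, 0) \<in> range to_ac \<and> v (0, 0) \<in> range to_ac"
  proof -
    have 0: "(0, 0) \<in> V" by (simp add: family_V_iff)
    obtain d f g h where form: "is_form d f" "is_form d g" "is_form d h" and h: "h (0, 0, 1) \<noteq> 0"
      and uv: "h (0, 0, 1) * u (0, 0) = f (0, 0, 1)" "h (0, 0, 1) * v (0, 0) = g (0, 0, 1)"
      using fractions[OF 0] 0 by blast
    have rational: "k (0, 0, 1) \<in> range to_ac" if "is_form d k" for k :: "'a alg_closure \<times> 'a alg_closure \<times> 'a alg_closure \<Rightarrow> 'a alg_closure"
      using is_form_rational[OF that, of 0 0 1] by simp
    obtain h0 f0 g0 where "h (0, 0, 1) = to_ac h0" "f (0, 0, 1) = to_ac f0" "g (0, 0, 1) = to_ac g0"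
      using form[THEN rational] by blast
    with h uv have "u (0, 0) = to_ac (f0 / h0)" "v (0, 0) = to_ac (g0 / h0)"
      by (simp_all add: field_simps)
    then show ?thesis by blast
  qed
  moreover have "\<forall>p\<in>V. (u p, v p) \<in> family_V b"
    "\<forall>p\<in>V. \<phi> (proj_pt (fst p, snd p, 1)) = proj_pt (u p, v p, 1)"
    using w by (simp_all add: u_def v_def)
  ultimately show thesis
    by (intro that[of u v]) blast+
qed

text \<open>Inserting the linear map into the target equation and eliminating y^2 gives F(x) + y
  G(x), which vanishes on the curve; by uniqueness of representations each coefficient is 0.\<close>

lemma family_coefficients:
  fixes \<alpha> \<beta> \<gamma> \<delta> \<epsilon> :: "'a::field alg_closure"
  assumes linear: "\<forall>(x, y) \<in> family_V a. (\<alpha> * x + \<beta>, \<gamma> * y + \<delta> * x + \<epsilon>) \<in> family_V b"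
  shows "\<epsilon>^2 + (to_ac b * \<beta> + 1) * \<epsilon> - \<beta>^3 = 0"
    "2 * \<delta> * \<epsilon> + to_ac b * \<alpha> * \<epsilon> + (to_ac b * \<beta> + 1) * \<delta> - 3 * \<alpha> * \<beta>^2 = 0"
    "\<delta>^2 + to_ac b * \<alpha> * \<delta> - 3 * \<alpha>^2 * \<beta> = 0"
    "\<gamma>^2 = \<alpha>^3"
    "2 * \<gamma> * \<epsilon> + (to_ac b * \<beta> + 1) * \<gamma> = \<gamma>^2"
    "2 * \<gamma> * \<delta> + to_ac b * \<alpha> * \<gamma> = to_ac a * \<gamma>^2"
proof -
  interpret cubic_curve "[:1, to_ac a:]" "monom 1 3" by (rule cubic_curve_family)
  let ?F = "[:\<epsilon>^2 + (to_ac b * \<beta> + 1) * \<epsilon> - \<beta>^3,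
    2 * \<delta> * \<epsilon> + to_ac b * \<alpha> * \<epsilon> + (to_ac b * \<beta> + 1) * \<delta> - 3 * \<alpha> * \<beta>^2,
    \<delta>^2 + to_ac b * \<alpha> * \<delta> - 3 * \<alpha>^2 * \<beta>, \<gamma>^2 - \<alpha>^3:]"
  let ?G = "[:2 * \<gamma> * \<epsilon> + (to_ac b * \<beta> + 1) * \<gamma> - \<gamma>^2,
    2 * \<gamma> * \<delta> + to_ac b * \<alpha> * \<gamma> - to_ac a * \<gamma>^2:]"
  have "poly ?F x + y * poly ?G x = 0" if xy: "(x, y) \<in> V" for x y
  proof -
    have 1: "y^2 = x^3 - (1 + to_ac a * x) * y"
      using xy unfolding family_V_iff by (simp add: algebra_simps)
    have 2: "(\<gamma> * y + \<delta> * x + \<epsilon>)^2 + (1 + to_ac b * (\<alpha> * x + \<beta>)) * (\<gamma> * y + \<delta> * x + \<epsilon>) - (\<alpha> * x + \<beta>)^3 = 0"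
    proof -
      have "(\<alpha> * x + \<beta>, \<gamma> * y + \<delta> * x + \<epsilon>) \<in> family_V b" using linear xy by blast
      then show ?thesis unfolding family_V_iff by simp
    qed
    have "(\<gamma> * y + \<delta> * x + \<epsilon>)^2 + (1 + to_ac b * (\<alpha> * x + \<beta>)) * (\<gamma> * y + \<delta> * x + \<epsilon>) - (\<alpha> * x + \<beta>)^3
      = \<gamma>^2 * y^2 + 2 * \<gamma> * y * (\<delta> * x + \<epsilon>) + (\<delta> * x + \<epsilon>)^2
        + (1 + to_ac b * (\<alpha> * x + \<beta>)) * (\<gamma> * y + \<delta> * x + \<epsilon>) - (\<alpha> * x + \<beta>)^3"
      by (simp add: algebra_simps power2_eq_square)
    also have "\<dots> = poly ?F x + y * poly ?G x"
      unfolding 1 by (simp add: algebra_simps power2_eq_square power3_eq_cube)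
    finally show ?thesis using 2 by simp
  qed
  then have "rep (\<lambda>p. 0) ?F ?G" by (auto simp: rep_def simp del: poly_pCons)
  moreover have "rep (\<lambda>p. 0) 0 0" by (simp add: rep_def)
  ultimately have "?F = 0 \<and> ?G = 0" by (rule rep_unique)
  then show "\<epsilon>^2 + (to_ac b * \<beta> + 1) * \<epsilon> - \<beta>^3 = 0"
    "2 * \<delta> * \<epsilon> + to_ac b * \<alpha> * \<epsilon> + (to_ac b * \<beta> + 1) * \<delta> - 3 * \<alpha> * \<beta>^2 = 0"
    "\<delta>^2 + to_ac b * \<alpha> * \<delta> - 3 * \<alpha>^2 * \<beta> = 0"
    "\<gamma>^2 = \<alpha>^3"
    "2 * \<gamma> * \<epsilon> + (to_ac b * \<beta> + 1) * \<gamma> = \<gamma>^2"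
    "2 * \<gamma> * \<delta> + to_ac b * \<alpha> * \<gamma> = to_ac a * \<gamma>^2"
    by (simp_all add: pCons_eq_0_iff)
qed

text \<open>A flex \<open>(r, t)\<close> with \<open>r \<noteq> 0\<close> would have \<open>(3 + b r)^3 = (3 t + b r)^3 = (b^3 - 27) r^3\<close>,
  hence \<open>t = 1\<close>.\<close>

lemma family_flexes:
  fixes b r t :: "'a::{field,finite}"
  assumes card: "[CARD('a) = 2] (mod 3)" and "b \<noteq> 3"
    and curve: "t^2 + b * r * t + t = r^3"
    and flex: "(3 * r^2 - b * t)^2 + b * (2 * t + b * r + 1) * (3 * r^2 - b * t) = 3 * r * (2 * t + b * r + 1)^2"
  shows "r = 0"
proof (rule ccontr)
  assume "r \<noteq> 0"
  \<comment> \<open>The 3-division polynomial. The flex hypothesis is s^2 + b s = 3 r for the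
    tangent slope s, with denominators cleared.\<close>
  have "r * (3 * r^3 + b^2 * r^2 + 3 * b * r + 3) = 0"
    using curve flex by Groebner_Basis.algebra
  with \<open>r \<noteq> 0\<close> have \<psi>: "3 * r^3 + b^2 * r^2 + 3 * b * r + 3 = 0" by simp
  have "(3 + b * r)^3 = 9 * (3 * r^3 + b^2 * r^2 + 3 * b * r + 3) + (b^3 - 27) * r^3"
    by (simp add: algebra_simps eval_nat_numeral)
  moreover have "(3 * t + b * r)^3 = 27 * t * (t^2 + b * r * t + t) - 27 * (t^2 + b * r * t + t)
     + 9 * t * (b^2 * r^2 + 3 * b * r + 3) + b^3 * r^3"
    by (simp add: algebra_simps eval_nat_numeral)
  then have "(3 * t + b * r)^3 = 9 * t * (3 * r^3 + b^2 * r^2 + 3 * b * r + 3) + (b^3 - 27) * r^3"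
    unfolding curve by (simp add: algebra_simps)
  ultimately have "(3 * t + b * r)^3 = (3 + b * r)^3" unfolding \<psi> by simp
  then have "3 * t + b * r = 3 + b * r" using injD[OF inj_cube[OF card]] by blast
  then have "3 * (t - 1) = 0" by (simp add: algebra_simps)
  then have "t = 1" using finite_field_3_neq_0[OF card] by simp
  then have "b * r + 2 = r^3" using curve by (simp add: add.commute)
  note r3 = this[symmetric]
  \<comment> \<open>With t = 1 the division polynomial becomes a square, which gives b r = - 3; then
    r^3 = - 1 and b = 3.\<close>
  have "3 * (b * r + 2) + b^2 * r^2 + 3 * b * r + 3 = 0" using \<psi> unfolding r3 .
  then have "(b * r + 3)^2 = 0" by (simp add: algebra_simps power2_eq_square)
  then have br: "b * r = - 3" by (simp add: eq_neg_iff_add_eq_0)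
  with r3 have "r^3 = (- 1)^3" by simp
  then have "r = - 1" using injD[OF inj_cube[OF card]] by blast
  with br \<open>b \<noteq> 3\<close> show False by simp
qed

lemma family_eq_if_isomorphic:
  fixes a b :: "'a::{field,finite}"
  assumes card: "[CARD('a) = 2] (mod 3)" and "b \<noteq> 3"
    and iso: "isomorphic (Weierstrass a 0 1 0 0) (Weierstrass b 0 1 0 0)"
  shows "a = b"
proof -
  let ?O = "proj_pt (0, 1, 0)"
  let ?E = "base_change (Weierstrass a 0 1 0 0)" and ?E' = "base_change (Weierstrass b 0 1 0 0)"
  obtain \<phi> \<psi> where \<phi>: "curve_morphism (Weierstrass a 0 1 0 0) (Weierstrass b 0 1 0 0) \<phi>"
    and \<psi>: "curve_morphism (Weierstrass b 0 1 0 0) (Weierstrass a 0 1 0 0) \<psi>"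
    and \<psi>\<phi>: "\<forall>P\<in>points ?E. \<psi> (\<phi> P) = P" and \<phi>\<psi>: "\<forall>P\<in>points ?E'. \<phi> (\<psi> P) = P"
    and \<phi>_O: "\<phi> ?O = ?O"
    using iso unfolding isomorphic_def by (elim exE conjE) (rule that)
  have \<psi>_O: "\<psi> ?O = ?O" using \<psi>\<phi> \<phi>_O infinity_in_points by metis
  interpret a: cubic_curve "[:1, to_ac a:]" "monom 1 3" by (rule cubic_curve_family)
  interpret b: cubic_curve "[:1, to_ac b:]" "monom 1 3" by (rule cubic_curve_family)
  have \<phi>_inf: "P = ?O" if "P \<in> points ?E" "\<phi> P = ?O" for P
    using \<psi>\<phi> \<psi>_O that by metis
  obtain u v where u: "a.regular u" and v: "a.regular v"
    and uv_all: "\<forall>p\<in>family_V a. (u p, v p) \<in> family_V b"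
    and \<phi>_uv: "\<forall>p\<in>family_V a. \<phi> (proj_pt (fst p, snd p, 1)) = proj_pt (u p, v p, 1)"
    and rational: "u (0, 0) \<in> range to_ac" "v (0, 0) \<in> range to_ac"
    by (rule morphism_coordinates[OF \<phi> \<phi>_inf]) (assumption | rule that)+
  note uv = uv_all[rule_format]
  have \<psi>_inf: "P = ?O" if "P \<in> points ?E'" "\<psi> P = ?O" for P
    using \<phi>\<psi> \<phi>_O that by metis
  obtain u' v' where u': "b.regular u'" and v': "b.regular v'"
    and \<psi>_uv: "\<forall>p\<in>family_V b. \<psi> (proj_pt (fst p, snd p, 1)) = proj_pt (u' p, v' p, 1)"
    by (rule morphism_coordinates[OF \<psi> \<psi>_inf]) (assumption | rule that)+
  \<comment> \<open>The inverse morphism expresses x and y through u and v, in the shape required by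
    \<open>pole_coordinates\<close>.\<close>
  obtain A B where AB: "b.rep u' A B" using u' by (auto simp: b.regular_def)
  obtain C D where CD: "b.rep v' C D" using v' by (auto simp: b.regular_def)
  have inv: "p = (u' (u p, v p), v' (u p, v p))" if p: "p \<in> family_V a" for p
  proof -
    obtain x y where xy: "p = (x, y)" by (cases p)
    have "proj_pt (x, y, 1) \<in> points ?E"
      unfolding points_eq affine_points_family using p xy by blast
    with \<psi>\<phi> have "\<psi> (\<phi> (proj_pt (x, y, 1))) = proj_pt (x, y, 1)" by blast
    then have "proj_pt (u' (u p, v p), v' (u p, v p), 1) = proj_pt (x, y, 1)"
      using bspec[OF \<phi>_uv p] bspec[OF \<psi>_uv uv[OF p]] by (simp add: xy)
    then show ?thesis by (simp add: xy)
  qed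
  have "v p ^ 2 + poly [:1, to_ac b:] (u p) * v p = poly (monom 1 3) (u p)" if "p \<in> family_V a" for p
    using uv[OF that] by (simp add: b.V_def)
  moreover have "fst p = poly A (u p) + v p * poly B (u p)" if "p \<in> family_V a" for p
    using arg_cong[OF inv[OF that], of fst] by (simp only: fst_conv b.repD[OF AB uv[OF that]])
  moreover have "snd p = poly C (u p) + v p * poly D (u p)" if "p \<in> family_V a" for p
    using arg_cong[OF inv[OF that], of snd] by (simp only: snd_conv b.repD[OF CD uv[OF that]])
  ultimately have "a.pole u 2" "a.pole v 3"
    using a.pole_coordinates[OF b.degree_h b.degree_f u v] by blast+
  obtain \<alpha> \<beta> where \<alpha>: "\<alpha> \<noteq> 0" and u_eq: "\<And>x y. (x, y) \<in> family_V a \<Longrightarrow> u (x, y) = \<alpha> * x + \<beta>"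
    by (rule a.pole_2E[OF \<open>a.pole u 2\<close>]) blast
  obtain \<gamma> \<delta> \<epsilon> where \<gamma>: "\<gamma> \<noteq> 0" and v_eq: "\<And>x y. (x, y) \<in> family_V a \<Longrightarrow> v (x, y) = \<gamma> * y + \<delta> * x + \<epsilon>"
    by (rule a.pole_3E[OF \<open>a.pole v 3\<close>]) blast
  have "\<forall>(x, y) \<in> family_V a. (\<alpha> * x + \<beta>, \<gamma> * y + \<delta> * x + \<epsilon>) \<in> family_V b"
  proof clarify
    fix x y assume "(x, y) \<in> family_V a"
    then show "(\<alpha> * x + \<beta>, \<gamma> * y + \<delta> * x + \<epsilon>) \<in> family_V b"
      using uv[of "(x, y)"] u_eq v_eq by simp
  qed
  note coeffs = family_coefficients[OF this]
  have "(0, 0) \<in> family_V a" by (simp add: family_V_iff)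
  then obtain r t where r: "\<beta> = to_ac r" and t: "\<epsilon> = to_ac t"
    using rational u_eq v_eq by auto
  have curve: "t^2 + b * r * t + t = r^3"
  proof -
    have "to_ac (t^2 + b * r * t + t - r^3) = 0"
      using coeffs(1) by (simp add: r t algebra_simps)
    then show ?thesis by (simp only: to_ac_eq_0_iff right_minus_eq)
  qed
  \<comment> \<open>m is F_y at the image (\<beta>, \<epsilon>) of the origin.\<close>
  define m where "m = 2 * \<epsilon> + to_ac b * \<beta> + 1"
  have "\<gamma> * m = \<gamma> * \<gamma>" using coeffs(5) by (simp add: m_def algebra_simps power2_eq_square)
  then have m: "\<gamma> = m" using \<gamma> by simp
  have \<delta>m: "\<delta> * m = \<alpha> * (3 * \<beta>^2 - to_ac b * \<epsilon>)"
    using coeffs(2) by (simp add: m_def algebra_simps)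
  \<comment> \<open>The line y = 0 goes to the tangent of slope \<delta> / \<alpha> at the image.
    The coefficient of x^2, multiplied by m^2, is the flex condition there, once \<delta> m is
    eliminated.\<close>
  have "\<alpha>^2 * ((3 * \<beta>^2 - to_ac b * \<epsilon>)^2 + to_ac b * m * (3 * \<beta>^2 - to_ac b * \<epsilon>) - 3 * \<beta> * m^2) = 0"
    using coeffs(3) \<delta>m by Groebner_Basis.algebra
  with \<alpha> have "(3 * \<beta>^2 - to_ac b * \<epsilon>)^2 + to_ac b * m * (3 * \<beta>^2 - to_ac b * \<epsilon>) - 3 * \<beta> * m^2 = 0"
    by simp
  then have "to_ac ((3 * r^2 - b * t)^2 + b * (2 * t + b * r + 1) * (3 * r^2 - b * t) - 3 * r * (2 * t + b * r + 1)^2) = 0"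
    by (simp add: m_def r t)
  then have "(3 * r^2 - b * t)^2 + b * (2 * t + b * r + 1) * (3 * r^2 - b * t) = 3 * r * (2 * t + b * r + 1)^2"
    by (simp only: to_ac_eq_0_iff right_minus_eq)
  from family_flexes[OF card \<open>b \<noteq> 3\<close> curve this] have "r = 0" .
  then have \<beta>: "\<beta> = 0" using r by simp
  \<comment> \<open>The image of the origin is (0, 0) or its opposite (0, -1); the second case
    differs from the first by the negation of the curve.\<close>
  have "\<epsilon> * (\<epsilon> + 1) = 0" using coeffs(1) by (simp add: \<beta> algebra_simps power2_eq_square)
  then consider "\<epsilon> = 0" | "\<epsilon> = - 1" by (auto simp: eq_neg_iff_add_eq_0)
  then have "to_ac a = to_ac b * \<alpha> \<and> \<alpha>^3 = 1"
  proof cases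
    case 1
    then have "\<gamma> = 1" using m by (simp add: m_def \<beta>)
    moreover have "\<delta> = 0" using coeffs(2) 1 by (simp add: \<beta>)
    ultimately show ?thesis using coeffs(4,6) by simp
  next
    case 2
    then have "\<gamma> = - 1" using m by (simp add: m_def \<beta>)
    moreover have "- \<delta> = to_ac b * \<alpha>" using coeffs(2) 2 by (simp add: \<beta> algebra_simps)
    then have "\<delta> = - (to_ac b * \<alpha>)" by (metis minus_minus)
    ultimately show ?thesis using coeffs(4,6) by (simp add: algebra_simps)
  qed
  \<comment> \<open>\<alpha> lies only in the closure and may differ from 1; cubing removes it and
    returns to F_q, where cubes determine elements.\<close>
  then have "to_ac (a^3) = to_ac (b^3)" by (simp add: power_mult_distrib)
  then have "a^3 = b^3" by (simp only: to_ac_eq_iff)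
  then show ?thesis using injD[OF inj_cube[OF card]] by blast
qed

section \<open>Isomorphism classes\<close>

lemma equiv_iso_rel: "equiv {E. elliptic_curve E} iso_rel"
proof (rule equivI)
  show "iso_rel \<subseteq> {E. elliptic_curve E} \<times> {E. elliptic_curve E}"
    by (auto simp: iso_rel_def)
  show "refl_on {E. elliptic_curve E} iso_rel"
    by (auto simp: refl_on_def iso_rel_def isomorphic_refl)
  show "sym iso_rel"
    by (auto simp: sym_def iso_rel_def isomorphic_sym)
  show "trans iso_rel"
    unfolding trans_def iso_rel_def using isomorphic_trans by blast
qed

theorem proposition3:
  fixes q :: nat
  assumes "CARD('a::{field,finite}) = q"
    and "[int q = -1] (mod 3)"
  shows "card (curves_3 // iso_rel :: 'a weierstrass set set) = q - 1 \<and>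
    (\<forall>a::'a. a \<noteq> 3 \<longrightarrow> Weierstrass a 0 1 0 0 \<in> curves_3) \<and>
    bij_betw (\<lambda>a::'a. iso_rel `` {Weierstrass a 0 1 0 0}) {a. a \<noteq> 3} (curves_3 // iso_rel)"
proof -
  have "int q mod 3 = 2" using assms(2) by (simp add: cong_def)
  then have card: "[CARD('a) = 2] (mod 3)" unfolding assms(1) cong_def by presburger
  let ?W = "\<lambda>a::'a. Weierstrass a 0 1 0 0"
  have W: "?W a \<in> curves_3" if "a \<noteq> 3" for a
    using elliptic_curve_normal_form[OF card that] three_dvd_card_points_normal_form[OF card that]
    by (simp add: curves_3_def)
  have ell: "elliptic_curve E" if "E \<in> curves_3" for E :: "'a weierstrass"
    using that by (simp add: curves_3_def)
  have "bij_betw (\<lambda>a. iso_rel `` {?W a}) {a. a \<noteq> 3} (curves_3 // iso_rel)"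
    unfolding bij_betw_def
  proof
    show "inj_on (\<lambda>a. iso_rel `` {?W a}) {a. a \<noteq> 3}"
    proof (rule inj_onI, unfold mem_Collect_eq)
      fix a b :: 'a
      assume ab: "a \<noteq> 3" "b \<noteq> 3" "iso_rel `` {?W a} = iso_rel `` {?W b}"
      then have "(?W a, ?W b) \<in> iso_rel"
        using eq_equiv_class_iff[OF equiv_iso_rel] ell[OF W] by blast
      then show "a = b"
        using family_eq_if_isomorphic[OF card ab(2)] by (simp add: iso_rel_def)
    qed
    show "(\<lambda>a. iso_rel `` {?W a}) ` {a. a \<noteq> 3} = curves_3 // iso_rel"
    proof
      show "(\<lambda>a. iso_rel `` {?W a}) ` {a. a \<noteq> 3} \<subseteq> curves_3 // iso_rel"
        using W by (auto intro: quotientI)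
      \<comment> \<open>The classes are taken among all elliptic curves, so it suffices that each
        class meeting \<open>curves_3\<close> contains a member of the family.\<close>
      show "curves_3 // iso_rel \<subseteq> (\<lambda>a. iso_rel `` {?W a}) ` {a. a \<noteq> 3}"
      proof
        fix K assume "K \<in> curves_3 // (iso_rel :: ('a weierstrass \<times> 'a weierstrass) set)"
        then obtain E where E: "E \<in> curves_3" "K = iso_rel `` {E}" by (rule quotientE)
        obtain a where a: "a \<noteq> 3" "isomorphic (?W a) E"
          using ex_isomorphic_normal_form[OF card E(1)] by blast
        then have "(?W a, E) \<in> iso_rel" using ell[OF W] ell[OF E(1)] by (simp add: iso_rel_def)
        then have "iso_rel `` {?W a} = K"
          unfolding E(2) by (rule equiv_class_eq[OF equiv_iso_rel])
        then show "K \<in> (\<lambda>a. iso_rel `` {?W a}) ` {a. a \<noteq> 3}" using a(1) by blast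
      qed
    qed
  qed
  moreover from this have "card (curves_3 // iso_rel :: 'a weierstrass set set) = card {a::'a. a \<noteq> 3}"
    by (simp add: bij_betw_same_card)
  moreover have "{a::'a. a \<noteq> 3} = UNIV - {3}" by auto
  ultimately show ?thesis using W assms(1) by simp
qed

end
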